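(* Let $(\Sigma,\mathcal G,(\mathcal G_t)_{t\ge0},\mathbb P)$ be a filtered probability space supporting a standard $(\mathcal G_t)$-Brownian motion $W$ starting at $0$, let $\tau$ be a $(\mathcal G_t)$-stopping time with $\mathbb P(\tau>0)>0$, and let $f:\mathbb R\to\mathbb R$ be a Borel function. If $f(W_{\cdot\wedge\tau})$ is a $(\mathcal G_t)$-semimartingale, then there exists $\delta>0$ such that the restriction $f|_{(-\delta,\delta)}$ is the difference of two convex functions from $(-\delta,\delta)$ into $\mathbb R$ (in particular, $f$ is continuous on $(-\delta,\delta)$).
   Context: Semimartingales are always assumed to have càdlàg paths. *)

theory Defs
  imports "HOL-Probability.Probability"
begin

text \<open>Continuous-time processes are indexed by real times; only times t \<ge> 0 matter.
  A process is a map X :: real \<Rightarrow> 'a \<Rightarrow> real, a filtration is F :: real \<Rightarrow> 'a measure.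
  Random times take values in [0,\<infinity>] and are modelled with type ennreal.\<close>

definition filtration_on :: "'a measure \<Rightarrow> (real \<Rightarrow> 'a measure) \<Rightarrow> bool" where
  "filtration_on M F \<longleftrightarrow>
     (\<forall>t\<ge>0. subalgebra M (F t)) \<and>
     (\<forall>s t. 0 \<le> s \<and> s \<le> t \<longrightarrow> sets (F s) \<subseteq> sets (F t))"

definition adapted :: "(real \<Rightarrow> 'a measure) \<Rightarrow> (real \<Rightarrow> 'a \<Rightarrow> real) \<Rightarrow> bool" where
  "adapted F X \<longleftrightarrow> (\<forall>t\<ge>0. X t \<in> borel_measurable (F t))"

definition stopping_time_on :: "'a measure \<Rightarrow> (real \<Rightarrow> 'a measure) \<Rightarrow> ('a \<Rightarrow> ennreal) \<Rightarrow> bool" where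
  "stopping_time_on M F T \<longleftrightarrow> (\<forall>t\<ge>0. {\<omega>\<in>space M. T \<omega> \<le> ennreal t} \<in> sets (F t))"

definition stopped :: "(real \<Rightarrow> 'a \<Rightarrow> 'b) \<Rightarrow> ('a \<Rightarrow> ennreal) \<Rightarrow> real \<Rightarrow> 'a \<Rightarrow> 'b" where
  "stopped X T t \<omega> = X (if T \<omega> < ennreal t then enn2real (T \<omega>) else t) \<omega>"

definition cadlag :: "(real \<Rightarrow> real) \<Rightarrow> bool" where
  "cadlag g \<longleftrightarrow> (\<forall>t\<ge>0. (g \<longlongrightarrow> g t) (at_right t)) \<and>
                 (\<forall>t>0. \<exists>l. (g \<longlongrightarrow> l) (at_left t))"

definition bounded_variation_on :: "(real \<Rightarrow> real) \<Rightarrow> real \<Rightarrow> real \<Rightarrow> bool" where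
  "bounded_variation_on g a b \<longleftrightarrow>
     (\<exists>B. \<forall>(n::nat) (s::nat \<Rightarrow> real).
        (\<forall>i\<le>n. a \<le> s i \<and> s i \<le> b) \<and> (\<forall>i<n. s i \<le> s (Suc i)) \<longrightarrow>
        (\<Sum>i<n. \<bar>g (s (Suc i)) - g (s i)\<bar>) \<le> B)"

definition martingale :: "'a measure \<Rightarrow> (real \<Rightarrow> 'a measure) \<Rightarrow> (real \<Rightarrow> 'a \<Rightarrow> real) \<Rightarrow> bool" where
  "martingale M F X \<longleftrightarrow> adapted F X \<and> (\<forall>t\<ge>0. integrable M (X t)) \<and>
     (\<forall>s t. 0 \<le> s \<and> s \<le> t \<longrightarrow> (AE \<omega> in M. real_cond_exp M (F s) (X t) \<omega> = X s \<omega>))"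

definition local_martingale :: "'a measure \<Rightarrow> (real \<Rightarrow> 'a measure) \<Rightarrow> (real \<Rightarrow> 'a \<Rightarrow> real) \<Rightarrow> bool" where
  "local_martingale M F X \<longleftrightarrow> adapted F X \<and> (AE \<omega> in M. cadlag (\<lambda>t. X t \<omega>)) \<and>
     (\<exists>T :: nat \<Rightarrow> 'a \<Rightarrow> ennreal. (\<forall>n. stopping_time_on M F (T n)) \<and>
        (AE \<omega> in M. incseq (\<lambda>n. T n \<omega>) \<and> (\<lambda>n. T n \<omega>) \<longlonglongrightarrow> \<infinity>) \<and>
        (\<forall>n. martingale M F (stopped X (T n))))"

definition finite_variation_process :: "'a measure \<Rightarrow> (real \<Rightarrow> 'a measure) \<Rightarrow> (real \<Rightarrow> 'a \<Rightarrow> real) \<Rightarrow> bool" where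
  "finite_variation_process M F A \<longleftrightarrow> adapted F A \<and>
     (AE \<omega> in M. cadlag (\<lambda>t. A t \<omega>) \<and> (\<forall>b\<ge>0. bounded_variation_on (\<lambda>t. A t \<omega>) 0 b))"

definition semimartingale :: "'a measure \<Rightarrow> (real \<Rightarrow> 'a measure) \<Rightarrow> (real \<Rightarrow> 'a \<Rightarrow> real) \<Rightarrow> bool" where
  "semimartingale M F X \<longleftrightarrow> adapted F X \<and> (AE \<omega> in M. cadlag (\<lambda>t. X t \<omega>)) \<and>
     (\<exists>L A. local_martingale M F L \<and> finite_variation_process M F A \<and>
        (\<forall>\<omega>\<in>space M. L 0 \<omega> = 0 \<and> A 0 \<omega> = 0) \<and>
        (AE \<omega> in M. \<forall>t\<ge>0. X t \<omega> = X 0 \<omega> + L t \<omega> + A t \<omega>))"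

definition brownian_motion :: "'a measure \<Rightarrow> (real \<Rightarrow> 'a measure) \<Rightarrow> (real \<Rightarrow> 'a \<Rightarrow> real) \<Rightarrow> bool" where
  "brownian_motion M F W \<longleftrightarrow> adapted F W \<and>
     (AE \<omega> in M. W 0 \<omega> = 0) \<and>
     (AE \<omega> in M. continuous_on {0..} (\<lambda>t. W t \<omega>)) \<and>
     (\<forall>s t. 0 \<le> s \<and> s < t \<longrightarrow>
        distributed M lborel (\<lambda>\<omega>. W t \<omega> - W s \<omega>) (\<lambda>x. ennreal (normal_density 0 (sqrt (t - s)) x)) \<and>
        (\<forall>A\<in>sets (F s). \<forall>B\<in>sets borel.
           measure M (A \<inter> {\<omega>\<in>space M. W t \<omega> - W s \<omega> \<in> B}) =
           measure M A * measure M {\<omega>\<in>space M. W t \<omega> - W s \<omega> \<in> B}))"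

end

(*
  A path of W that, before tau, takes a positive, a negative and again a positive value passes every
  level between upwards and downwards.  Looking at the last passage time, right-continuity of
  f(W) along this single path already makes f continuous near 0.  Such paths have positive
  probability because {tau > 0} belongs to F_0 and is therefore independent of W.

  Let g be a bounded continuous function that agrees with f near 0 and let P_h be the heat semigroup.
  Test f(W) at the grid times kh with the signs of P_h g - g at W(kh), up to the time where
  tau, a localizing time of L, an exit time of W or a level of the variation of A is reached.
  This bounds E(sum_k |P_h g - g|(W(kh))) uniformly in h.
  On a short time interval [0,T] the bad set where one stops early is a small fraction of {tau > 0},
  so first and second moments of the occupation sum show that |P_h g - g| has integral O(h) over an
  interval (-r,r).

  Finally, if G'' = g, then u_h = 2(P_h G - G)/h converges pointwise to g, and
  u_h'' = 2(P_h g - g)/h is bounded in L^1(-r,r).  Hence Phi_h with Phi_h'' = (u_h'')^+ is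
  equi-Lipschitz, a subsequence converges, and both lim Phi_h and lim Phi_h - g are convex.
*)
theory Submission
  imports Defs "HOL-Complex_Analysis.Great_Picard"
begin

text \<open>Neither Ito's formula nor local times can be applied to a merely Borel \<open>f\<close>;
  continuity has to come from single paths, and it is what makes a bounded continuous
  \<open>g\<close> available. The target is a signed measure as second derivative, and an L^1 bound
  on \<open>2 / h * (heat h g x - g x)\<close> uniform in \<open>h\<close> is its form at positive
  \<open>h\<close>. The filtration is not assumed right-continuous or complete. So {tau > 0} need
  not have probability 0 or 1, and exit times of \<open>W\<close> need not be stopping times: {tau >
  0} is carried along as a factor \<open>measure M D\<close>, and early stopping is monitored at
  grid times by decreasing sets. The decisive obstacle is that early stopping depends on
  \<open>W\<close>, while the test function depends on \<open>h\<close>. A first moment over all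
  paths says nothing about the good paths unless the occupation sum cannot concentrate on a set of
  small probability. The second moment rules this out uniformly, because it involves only the
  integral and the supremum of the test function, and the supremum is at most twice the bound of
  \<open>g\<close>.\<close>

section \<open>Continuity from last passage times\<close>

text \<open>At the last time \<open>u\<close> with \<open>w u \<le> x\<close> the path sits at
  \<open>x\<close> and stays strictly above it afterwards, so by the intermediate value theorem
  \<open>w\<close> covers a right neighbourhood of \<open>x\<close> within any short time after
  \<open>u\<close>. Right-continuity in time thereby becomes a one-sided limit in space. The
  argument is pathwise, so it does not matter that \<open>u\<close> is no stopping time.\<close>

lemma right_limit_at_last_passage:
  fixes w f :: "real \<Rightarrow> real"
  assumes w: "continuous_on {s..t} w" and "s < t"
    and rc: "\<And>u. s \<le> u \<Longrightarrow> u < t \<Longrightarrow> ((\<lambda>u. f (w u)) \<longlongrightarrow> f (w u)) (at_right u)"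
    and x: "w s < x" "x < w t"
  shows "(f \<longlongrightarrow> f x) (at_right x)"
proof -
  define S where "S = {u\<in>{s..t}. w u \<le> x}"
  have "closed S" unfolding S_def
    by (rule continuous_on_closed_Collect_le) (use w in \<open>auto intro: continuous_intros\<close>)
  moreover have "s \<in> S" "bdd_above S" using x \<open>s < t\<close> by (auto simp: S_def)
  moreover from this have "S \<noteq> {}" by auto
  ultimately have uS: "Sup S \<in> S" by (intro closed_contains_Sup) auto
  define u where "u = Sup S"
  have u: "s \<le> u" "u \<le> t" "w u \<le> x" using uS by (auto simp: S_def u_def)
  have ut: "u < t" using u x by (cases "u = t") auto
  have above: "x < w v" if "u < v" "v \<le> t" for v
  proof (rule ccontr)
    assume "\<not> x < w v"
    then have "v \<in> S" using that u by (auto simp: S_def)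
    then show False using cSup_upper[of v S] \<open>bdd_above S\<close> that by (auto simp: u_def)
  qed
  have wu: "w u = x"
  proof (rule ccontr)
    assume "w u \<noteq> x"
    then have "w u < x" using u by simp
    with x ut obtain v where "u \<le> v" "v \<le> t" "w v = x"
      using IVT'[of w u x t] continuous_on_subset[OF w, of "{u..t}"] u by auto
    with above \<open>w u < x\<close> show False by (metis less_irrefl nless_le)
  qed
  show ?thesis
  proof (rule tendstoI)
    fix e :: real assume "e > 0"
    from tendstoD[OF rc[OF u(1) ut] this] obtain d where d: "d > u"
      "\<And>v. u < v \<Longrightarrow> v < d \<Longrightarrow> dist (f (w v)) (f x) < e"
      unfolding eventually_at_right_field wu by auto
    define v0 where "v0 = (u + min d t) / 2"
    have v0: "u < v0" "v0 < d" "v0 < t" using d ut by (auto simp: v0_def min_def field_simps)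
    have "dist (f y) (f x) < e" if y: "x < y" "y < w v0" for y
    proof -
      obtain v where "u \<le> v" "v \<le> v0" "w v = y"
        using IVT'[of w u y v0] continuous_on_subset[OF w, of "{u..v0}"] u y v0 wu by auto
      with y wu v0 show ?thesis by (intro d(2)[of v, simplified \<open>w v = y\<close>]) (auto simp: less_le)
    qed
    moreover have "x < w v0" using above v0 by simp
    ultimately show "\<forall>\<^sub>F y in at_right x. dist (f y) (f x) < e"
      unfolding eventually_at_right_field by blast
  qed
qed

lemma left_limit_at_last_passage:
  fixes w f :: "real \<Rightarrow> real"
  assumes w: "continuous_on {s..t} w" and "s < t"
    and rc: "\<And>u. s \<le> u \<Longrightarrow> u < t \<Longrightarrow> ((\<lambda>u. f (w u)) \<longlongrightarrow> f (w u)) (at_right u)"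
    and x: "w t < x" "x < w s"
  shows "(f \<longlongrightarrow> f x) (at_left x)"
proof -
  have "((\<lambda>y. f (- y)) \<longlongrightarrow> f (- (- x))) (at_right (- x))"
    by (rule right_limit_at_last_passage[where w = "\<lambda>u. - w u" and s = s and t = t])
      (use assms in \<open>auto intro: continuous_intros\<close>)
  then show ?thesis by (simp add: filterlim_at_left_to_right)
qed

text \<open>A last passage sees \<open>f\<close> only on the side to which the path leaves. The
  upcrossing from \<open>s2\<close> to \<open>s3\<close> gives the limit from above, the
  downcrossing from \<open>s1\<close> to \<open>s2\<close> the limit from below.\<close>

lemma isCont_of_alternating_path:
  fixes w f :: "real \<Rightarrow> real"
  assumes w: "continuous_on {s1..s3} w" and s: "s1 < s2" "s2 < s3"
    and rc: "\<And>u. s1 \<le> u \<Longrightarrow> u < s3 \<Longrightarrow> ((\<lambda>u. f (w u)) \<longlongrightarrow> f (w u)) (at_right u)"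
    and x: "w s2 < x" "x < w s1" "x < w s3"
  shows "isCont f x"
proof -
  have "(f \<longlongrightarrow> f x) (at_right x)"
    by (rule right_limit_at_last_passage[where w = w and s = s2 and t = s3])
      (use assms in \<open>auto intro: continuous_on_subset[OF w]\<close>)
  moreover have "(f \<longlongrightarrow> f x) (at_left x)"
    by (rule left_limit_at_last_passage[where w = w and s = s1 and t = s2])
      (use assms in \<open>auto intro: continuous_on_subset[OF w]\<close>)
  ultimately show ?thesis by (simp add: isCont_def filterlim_split_at)
qed

section \<open>The heat semigroup\<close>

text \<open>The kernel has variance \<open>h\<close>, like an increment of \<open>W\<close> over
  time \<open>h\<close>; the generator is half the second derivative, which is where the factors
  \<open>2 / h\<close> below come from.\<close>

definition heat :: "real \<Rightarrow> (real \<Rightarrow> real) \<Rightarrow> real \<Rightarrow> real" where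
  "heat h g x = (\<integral>z. normal_density 0 (sqrt h) z * g (x + z) \<partial>lborel)"

text \<open>Quadratic growth is the class reached by the second antiderivative of a bounded
  function, on which the semigroup has to act later.\<close>

lemma integrable_normal_polynomial_bound:
  assumes "h > 0" and [measurable]: "g \<in> borel_measurable borel"
    and "\<And>z. \<bar>g z\<bar> \<le> a + b * \<bar>z\<bar> + c * z\<^sup>2"
  shows "integrable lborel (\<lambda>z. normal_density 0 (sqrt h) z * g z)"
proof (rule Bochner_Integration.integrable_bound)
  let ?n = "normal_density 0 (sqrt h)"
  have h: "sqrt h > 0" using assms by simp
  show "integrable lborel (\<lambda>z. a * ?n z + b * (?n z * \<bar>z - 0\<bar> ^ 1) + c * (?n z * (z - 0) ^ 2))"
    by (intro Bochner_Integration.integrable_add integrable_mult_right integrable_normal_moment_abs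
        integrable_normal_moment integrable_normal_density h)
  have "\<bar>?n z * g z\<bar> \<le> a * ?n z + b * (?n z * \<bar>z\<bar>) + c * (?n z * z\<^sup>2)" for z
    using mult_left_mono[OF assms(3)[of z] normal_density_nonneg[of 0 "sqrt h" z]]
    by (simp add: abs_mult algebra_simps)
  then show "AE z in lborel. norm (?n z * g z) \<le> norm (a * ?n z + b * (?n z * \<bar>z - 0\<bar> ^ 1) + c * (?n z * (z - 0) ^ 2))"
    by (auto intro: order_trans[OF _ abs_ge_self])
qed simp

text \<open>Serves twice: as the growth bound that lets the semigroup act on \<open>g\<close>, and
  as the majorant of its difference quotients.\<close>

lemma abs_increment_le_of_linear_deriv_bound:
  fixes g :: "real \<Rightarrow> real"
  assumes g: "\<And>y. DERIV g y :> g' y" and g': "\<And>y. \<bar>g' y\<bar> \<le> a + b * \<bar>y\<bar>" and "b \<ge> 0"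
  shows "\<bar>g (y + k) - g y\<bar> \<le> \<bar>k\<bar> * (a + b * (\<bar>y\<bar> + \<bar>k\<bar>))"
proof -
  have "norm (g (y + k) - g y) \<le> (a + b * (\<bar>y\<bar> + \<bar>k\<bar>)) * norm (y + k - y)"
  proof (rule field_differentiable_bound)
    show "convex {min y (y + k)..max y (y + k)}" by simp
    show "(g has_field_derivative g' z) (at z within {min y (y + k)..max y (y + k)})" for z
      using g by (rule has_field_derivative_at_within)
    fix z assume "z \<in> {min y (y + k)..max y (y + k)}"
    then have "\<bar>z\<bar> \<le> \<bar>y\<bar> + \<bar>k\<bar>" by (auto simp: min_def max_def split: if_splits)
    then show "norm (g' z) \<le> a + b * (\<bar>y\<bar> + \<bar>k\<bar>)"
      using g'[of z] mult_left_mono[of "\<bar>z\<bar>" "\<bar>y\<bar> + \<bar>k\<bar>" b] \<open>b \<ge> 0\<close> by auto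
  qed auto
  then show ?thesis by (simp add: mult.commute)
qed

lemma integrable_heat_of_linear_deriv_bound:
  fixes g :: "real \<Rightarrow> real"
  assumes "h > 0" and g: "\<And>y. DERIV g y :> g' y"
    and g': "\<And>y. \<bar>g' y\<bar> \<le> a + b * \<bar>y\<bar>" and "b \<ge> 0"
  shows "integrable lborel (\<lambda>z. normal_density 0 (sqrt h) z * g (x + z))"
proof (rule integrable_normal_polynomial_bound[OF \<open>h > 0\<close>])
  have "continuous_on UNIV g"
    by (rule DERIV_continuous_on) (rule has_field_derivative_at_within[OF g])
  then have [measurable]: "g \<in> borel_measurable borel" by (rule borel_measurable_continuous_onI)
  show "(\<lambda>z. g (x + z)) \<in> borel_measurable borel" by measurable
  fix z
  show "\<bar>g (x + z)\<bar> \<le> \<bar>g x\<bar> + (a + b * \<bar>x\<bar>) * \<bar>z\<bar> + b * z\<^sup>2"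
    using abs_increment_le_of_linear_deriv_bound[OF g g' \<open>b \<ge> 0\<close>, of x z]
    by (auto simp: algebra_simps power2_eq_square abs_mult)
qed

text \<open>Dominated convergence of difference quotients along sequences. Derivatives fall on
  \<open>G\<close> and \<open>G'\<close> only, so the function at the bottom of the chain may be
  merely continuous; two applications give the second derivative of
  \<open>2 / h * (heat h G x - G x)\<close> as
  \<open>2 / h * (heat h G'' x - G'' x)\<close>.\<close>

lemma DERIV_heat:
  fixes g :: "real \<Rightarrow> real"
  assumes "h > 0" and g: "\<And>y. DERIV g y :> g' y" and [measurable]: "g' \<in> borel_measurable borel"
    and g': "\<And>y. \<bar>g' y\<bar> \<le> a + b * \<bar>y\<bar>" and "b \<ge> 0"
  shows "DERIV (heat h g) x :> heat h g' x"
  unfolding DERIV_def tendsto_at_iff_sequentially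
proof (intro allI impI)
  let ?n = "normal_density 0 (sqrt h)"
  fix X :: "nat \<Rightarrow> real"
  assume X: "\<forall>i. X i \<in> UNIV - {0}" "X \<longlonglongrightarrow> 0"
  have "continuous_on UNIV g"
    by (rule DERIV_continuous_on) (rule has_field_derivative_at_within[OF g])
  then have [measurable]: "g \<in> borel_measurable borel" by (rule borel_measurable_continuous_onI)
  obtain B where B: "\<And>i. \<bar>X i\<bar> \<le> B"
    using convergent_imp_Bseq[OF convergentI[OF X(2)]] by (auto simp: Bseq_def)
  note int = integrable_heat_of_linear_deriv_bound[OF \<open>h > 0\<close> g g' \<open>b \<ge> 0\<close>]
  have quot: "(heat h g (x + X i) - heat h g x) / X i =
      (\<integral>z. ?n z * ((g (x + z + X i) - g (x + z)) / X i) \<partial>lborel)" for i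
  proof -
    have "heat h g (x + X i) - heat h g x = (\<integral>z. ?n z * g (x + X i + z) - ?n z * g (x + z) \<partial>lborel)"
      unfolding heat_def by (rule Bochner_Integration.integral_diff[symmetric]; rule int)
    then have "(heat h g (x + X i) - heat h g x) / X i =
        (\<integral>z. (?n z * g (x + X i + z) - ?n z * g (x + z)) / X i \<partial>lborel)"
      by simp
    also have "\<dots> = (\<integral>z. ?n z * ((g (x + z + X i) - g (x + z)) / X i) \<partial>lborel)"
    proof (rule Bochner_Integration.integral_cong[OF refl])
      fix z
      have "x + X i + z = x + z + X i" by simp
      then show "(?n z * g (x + X i + z) - ?n z * g (x + z)) / X i = ?n z * ((g (x + z + X i) - g (x + z)) / X i)"
        by (simp only: times_divide_eq_right right_diff_distrib)
    qed
    finally show ?thesis .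
  qed
  have "(\<lambda>i. \<integral>z. ?n z * ((g (x + z + X i) - g (x + z)) / X i) \<partial>lborel) \<longlonglongrightarrow> (\<integral>z. ?n z * g' (x + z) \<partial>lborel)"
  proof (rule integral_dominated_convergence)
    show "integrable lborel (\<lambda>z. ?n z * (a + b * (\<bar>x\<bar> + B) + b * \<bar>z\<bar>))"
    proof (rule integrable_normal_polynomial_bound[OF \<open>h > 0\<close>])
      fix z
      show "\<bar>a + b * (\<bar>x\<bar> + B) + b * \<bar>z\<bar>\<bar> \<le> (\<bar>a + b * (\<bar>x\<bar> + B)\<bar>) + b * \<bar>z\<bar> + 0 * z\<^sup>2"
        using \<open>b \<ge> 0\<close> abs_triangle_ineq[of "a + b * (\<bar>x\<bar> + B)" "b * \<bar>z\<bar>"] by (simp add: abs_mult)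
    qed measurable
    have "((\<lambda>i. (g (x + z + X i) - g (x + z)) / X i) \<longlonglongrightarrow> g' (x + z))" for z
      using g[of "x + z"] X unfolding DERIV_def tendsto_at_iff_sequentially comp_def by auto
    then show "AE z in lborel. (\<lambda>i. ?n z * ((g (x + z + X i) - g (x + z)) / X i)) \<longlonglongrightarrow> ?n z * g' (x + z)"
      by (intro AE_I2 tendsto_intros)
    fix i
    have "\<bar>(g (x + z + X i) - g (x + z)) / X i\<bar> \<le> a + b * (\<bar>x\<bar> + B) + b * \<bar>z\<bar>" for z
    proof -
      have "\<bar>(g (x + z + X i) - g (x + z)) / X i\<bar> \<le> a + b * (\<bar>x + z\<bar> + \<bar>X i\<bar>)"
        using abs_increment_le_of_linear_deriv_bound[OF g g' \<open>b \<ge> 0\<close>, of "x + z" "X i"] X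
        by (simp add: abs_divide divide_le_eq mult.commute)
      also have "\<dots> \<le> a + b * ((\<bar>x\<bar> + \<bar>z\<bar>) + B)"
        using \<open>b \<ge> 0\<close> B[of i] by (intro add_left_mono mult_left_mono add_mono) auto
      finally show ?thesis by (simp add: algebra_simps)
    qed
    then show "AE z in lborel. norm (?n z * ((g (x + z + X i) - g (x + z)) / X i)) \<le> ?n z * (a + b * (\<bar>x\<bar> + B) + b * \<bar>z\<bar>)"
      unfolding real_norm_def abs_mult abs_of_nonneg[OF normal_density_nonneg]
      by (intro AE_I2 mult_left_mono) auto
  qed measurable
  then show "((\<lambda>k. (heat h g (x + k) - heat h g x) / k) \<circ> X) \<longlonglongrightarrow> heat h g' x"
    by (simp add: comp_def quot heat_def[of h g'])
qed

text \<open>Within distance \<open>d\<close> the Taylor remainder is small by the closeness of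
  \<open>G''\<close> to its value at \<open>x\<close>. Beyond it the crude bound
  \<open>C * z\<^sup>2\<close> is traded for \<open>C * z ^ 4 / d\<^sup>2\<close>: the fourth
  Gaussian moment is of order \<open>h\<^sup>2\<close> and still vanishes after division by
  \<open>h\<close>.\<close>

lemma second_order_remainder_bound:
  fixes G :: "real \<Rightarrow> real"
  assumes G: "\<And>y. DERIV G y :> G' y" and G': "\<And>y. DERIV G' y :> G'' y"
    and bd: "\<And>y. \<bar>G'' y\<bar> \<le> C" and "d > 0"
    and near: "\<And>y. \<bar>y - x\<bar> < d \<Longrightarrow> \<bar>G'' y - G'' x\<bar> \<le> e"
  shows "\<bar>G (x + z) - G x - G' x * z - G'' x * z\<^sup>2 / 2\<bar> \<le> e * z\<^sup>2 / 2 + C * z ^ 4 / d\<^sup>2"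
proof (cases "z = 0")
  case False
  define D where "D m = (if m = 0 then G else if m = 1 then G' else G'')" for m :: nat
  have "\<exists>t. (if x + z < x then x + z < t \<and> t < x else x < t \<and> t < x + z) \<and>
     G (x + z) = (\<Sum>m<2. D m x / fact m * (x + z - x) ^ m) + D 2 t / fact 2 * (x + z - x)\<^sup>2"
    by (rule Taylor[of 2 D G "min x (x + z)" "max x (x + z)" x "x + z"])
      (use G G' False in \<open>auto simp: D_def less_Suc_eq numeral_2_eq_2\<close>)
  then obtain t where t: "if x + z < x then x + z < t \<and> t < x else x < t \<and> t < x + z"
    "G (x + z) = G x + G' x * z + G'' t / 2 * z\<^sup>2"
    by (auto simp: D_def numeral_2_eq_2)
  have tz: "\<bar>t - x\<bar> < \<bar>z\<bar>" using t(1) by (auto split: if_splits)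
  have "\<bar>G (x + z) - G x - G' x * z - G'' x * z\<^sup>2 / 2\<bar> = \<bar>(G'' t - G'' x) * (z\<^sup>2 / 2)\<bar>"
    unfolding t(2) by (rule arg_cong[where f = abs]) (simp add: field_simps)
  also have "\<dots> = \<bar>G'' t - G'' x\<bar> * z\<^sup>2 / 2" by (simp add: abs_mult)
  also have "\<dots> \<le> e * z\<^sup>2 / 2 + C * z ^ 4 / d\<^sup>2"
  proof (cases "\<bar>z\<bar> < d")
    case True
    have "C \<ge> 0" using bd[of 0] by simp
    then have "0 \<le> C * z ^ 4 / d\<^sup>2" by simp
    moreover have "\<bar>G'' t - G'' x\<bar> * z\<^sup>2 \<le> e * z\<^sup>2"
      using near[of t] tz True by (intro mult_right_mono) auto
    ultimately show ?thesis by argo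
  next
    case False
    have "e \<ge> 0" using near[of x] \<open>d > 0\<close> by simp
    have "d\<^sup>2 \<le> z\<^sup>2" using False \<open>d > 0\<close> by (metis abs_le_square_iff abs_of_pos not_less)
    have "\<bar>G'' t - G'' x\<bar> * z\<^sup>2 \<le> 2 * C * z\<^sup>2"
      using bd[of t] bd[of x] by (intro mult_right_mono) auto
    also have "C * z\<^sup>2 * d\<^sup>2 \<le> C * z\<^sup>2 * z\<^sup>2"
      using \<open>d\<^sup>2 \<le> z\<^sup>2\<close> bd[of 0] by (intro mult_left_mono) auto
    then have "2 * C * z\<^sup>2 \<le> 2 * (C * z ^ 4 / d\<^sup>2)"
      using \<open>d > 0\<close> by (simp add: field_simps power4_eq_xxxx power2_eq_square)
    finally show ?thesis using mult_nonneg_nonneg[OF \<open>e \<ge> 0\<close> zero_le_power2[of z]] by argo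
  qed
  finally show ?thesis .
qed simp

text \<open>The Gaussian moments of orders 0, 1, 2, 4 are 1, 0, \<open>h\<close>,
  \<open>3 * h\<^sup>2\<close>. Integrating the Taylor remainder leaves
  \<open>e / 2 * h + 3 * C * h\<^sup>2 / d\<^sup>2\<close>, which the factor \<open>2 / h\<close>
  turns into the stated bound.\<close>

lemma heat_generator_estimate:
  fixes G :: "real \<Rightarrow> real"
  assumes G: "\<And>y. DERIV G y :> G' y" and G': "\<And>y. DERIV G' y :> G'' y"
    and bd: "\<And>y. \<bar>G'' y\<bar> \<le> C" and "d > 0" and "h > 0"
    and near: "\<And>y. \<bar>y - x\<bar> < d \<Longrightarrow> \<bar>G'' y - G'' x\<bar> \<le> e"
  shows "\<bar>2 / h * (heat h G x - G x) - G'' x\<bar> \<le> e + 6 * C * h / d\<^sup>2"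
proof -
  let ?n = "normal_density 0 (sqrt h)"
  let ?R = "\<lambda>z. G (x + z) - G x - G' x * z - G'' x * z\<^sup>2 / 2"
  have h: "sqrt h > 0" using \<open>h > 0\<close> by simp
  have G'_bd: "\<bar>G' y\<bar> \<le> \<bar>G' 0\<bar> + C * \<bar>y\<bar>" for y
    using abs_increment_le_of_linear_deriv_bound[OF G', of C 0 0 y] bd by (auto simp: mult.commute)
  have "C \<ge> 0" using bd[of 0] by simp
  have m0: "has_bochner_integral lborel ?n 1"
    by (simp add: has_bochner_integral_iff integrable_normal_density[OF h] integral_normal_density[OF h])
  have m1: "has_bochner_integral lborel (\<lambda>z. ?n z * z) 0"
    using normal_moment_nz_1[OF h, of 0] by simp
  have m2: "has_bochner_integral lborel (\<lambda>z. ?n z * z\<^sup>2) h"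
    using normal_moment_even[OF h, of 0 1] \<open>h > 0\<close> by (simp add: fact_numeral)
  have m4: "has_bochner_integral lborel (\<lambda>z. ?n z * z ^ 4) (3 * h\<^sup>2)"
    using normal_moment_even[OF h, of 0 2] \<open>h > 0\<close> by (simp add: fact_numeral power2_eq_square field_simps)
  have "has_bochner_integral lborel (\<lambda>z. ?n z * G (x + z)) (heat h G x)"
    unfolding heat_def
    by (intro has_bochner_integral_integrable integrable_heat_of_linear_deriv_bound[OF \<open>h > 0\<close> G G'_bd \<open>C \<ge> 0\<close>])
  then have "has_bochner_integral lborel
      (\<lambda>z. ?n z * G (x + z) - G x * ?n z - G' x * (?n z * z) - G'' x / 2 * (?n z * z\<^sup>2))
      (heat h G x - G x * 1 - G' x * 0 - G'' x / 2 * h)"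
    by (intro has_bochner_integral_diff has_bochner_integral_mult_right m0 m1 m2)
  then have R: "has_bochner_integral lborel (\<lambda>z. ?n z * ?R z) (heat h G x - G x - G'' x / 2 * h)"
    by (simp add: algebra_simps)
  have bound: "has_bochner_integral lborel (\<lambda>z. e / 2 * (?n z * z\<^sup>2) + C / d\<^sup>2 * (?n z * z ^ 4))
     (e / 2 * h + C / d\<^sup>2 * (3 * h\<^sup>2))"
    by (intro has_bochner_integral_add has_bochner_integral_mult_right m2 m4)
  have "\<bar>heat h G x - G x - G'' x / 2 * h\<bar> \<le> (\<integral>z. \<bar>?n z * ?R z\<bar> \<partial>lborel)"
    using integral_norm_bound[of lborel "\<lambda>z. ?n z * ?R z"] has_bochner_integral_integral_eq[OF R] by simp
  also have "\<dots> \<le> (\<integral>z. e / 2 * (?n z * z\<^sup>2) + C / d\<^sup>2 * (?n z * z ^ 4) \<partial>lborel)"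
  proof (rule integral_mono)
    show "integrable lborel (\<lambda>z. \<bar>?n z * ?R z\<bar>)" using R by (simp add: has_bochner_integral_iff)
    show "integrable lborel (\<lambda>z. e / 2 * (?n z * z\<^sup>2) + C / d\<^sup>2 * (?n z * z ^ 4))"
      using bound by (simp add: has_bochner_integral_iff)
    fix z
    show "\<bar>?n z * ?R z\<bar> \<le> e / 2 * (?n z * z\<^sup>2) + C / d\<^sup>2 * (?n z * z ^ 4)"
      using mult_left_mono[OF second_order_remainder_bound[OF G G' bd \<open>d > 0\<close> near, of z]
          normal_density_nonneg[of 0 "sqrt h" z]]
      unfolding abs_mult abs_of_nonneg[OF normal_density_nonneg] by (simp add: distrib_left mult.left_commute)
  qed
  also have "\<dots> = e / 2 * h + C / d\<^sup>2 * (3 * h\<^sup>2)" using bound by (rule has_bochner_integral_integral_eq)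
  finally have "2 / h * \<bar>heat h G x - G x - G'' x / 2 * h\<bar> \<le> 2 / h * (e / 2 * h + C / d\<^sup>2 * (3 * h\<^sup>2))"
    using \<open>h > 0\<close> by (intro mult_left_mono) auto
  moreover have "2 / h * \<bar>heat h G x - G x - G'' x / 2 * h\<bar> = \<bar>2 / h * (heat h G x - G x) - G'' x\<bar>"
  proof -
    have "2 / h * (heat h G x - G x - G'' x / 2 * h) = 2 / h * (heat h G x - G x) - G'' x"
      using \<open>h > 0\<close> by (simp add: field_simps)
    then show ?thesis using \<open>h > 0\<close> by (metis abs_mult abs_of_pos zero_less_divide_iff zero_less_numeral)
  qed
  moreover have "2 / h * (e / 2 * h + C / d\<^sup>2 * (3 * h\<^sup>2)) = e + 6 * C * h / d\<^sup>2"
    using \<open>h > 0\<close> \<open>d > 0\<close> by (simp add: field_simps power2_eq_square)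
  ultimately show ?thesis by simp
qed

lemma heat_generator_tendsto:
  fixes G :: "real \<Rightarrow> real"
  assumes G: "\<And>y. DERIV G y :> G' y" and G': "\<And>y. DERIV G' y :> G'' y"
    and bd: "\<And>y. \<bar>G'' y\<bar> \<le> C" and cont: "isCont G'' x"
    and h: "\<And>i. h i > 0" "h \<longlonglongrightarrow> 0"
  shows "(\<lambda>i. 2 / h i * (heat (h i) G x - G x)) \<longlonglongrightarrow> G'' x"
proof (rule tendstoI)
  fix e :: real assume "e > 0"
  obtain d where "d > 0" and d: "\<And>y. \<bar>y - x\<bar> < d \<Longrightarrow> \<bar>G'' y - G'' x\<bar> < e / 2"
    using cont \<open>e > 0\<close> unfolding continuous_at_eps_delta dist_real_def by (meson half_gt_zero)
  have "(\<lambda>i. e / 2 + 6 * C * h i / d\<^sup>2) \<longlonglongrightarrow> e / 2 + 6 * C * 0 / d\<^sup>2"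
    using \<open>d > 0\<close> by (intro tendsto_intros h) auto
  from order_tendstoD(2)[OF this, of e]
  have "\<forall>\<^sub>F i in sequentially. e / 2 + 6 * C * h i / d\<^sup>2 < e"
    using \<open>e > 0\<close> by simp
  then show "\<forall>\<^sub>F i in sequentially. dist (2 / h i * (heat (h i) G x - G x)) (G'' x) < e"
  proof eventually_elim
    case (elim i)
    have "\<bar>2 / h i * (heat (h i) G x - G x) - G'' x\<bar> \<le> e / 2 + 6 * C * h i / d\<^sup>2"
      by (rule heat_generator_estimate[OF G G' bd \<open>d > 0\<close> h(1)]) (use d in force)
    with elim show ?case by (simp add: dist_real_def)
  qed
qed

section \<open>Differences of convex functions\<close>

lemma convex_on_limit:
  fixes F :: "nat \<Rightarrow> real \<Rightarrow> real"
  assumes "\<And>i. convex_on S (F i)" and lim: "\<And>x. x \<in> S \<Longrightarrow> (\<lambda>i. F i x) \<longlonglongrightarrow> g x"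
  shows "convex_on S g"
proof -
  have "convex S" using assms(1) by (simp add: convex_on_def)
  show ?thesis
    unfolding convex_on_def
  proof (intro conjI ballI allI impI \<open>convex S\<close>)
    fix x y u v :: real
    assume *: "x \<in> S" "y \<in> S" "0 \<le> u" "0 \<le> v" "u + v = 1"
    then have "u *\<^sub>R x + v *\<^sub>R y \<in> S" using \<open>convex S\<close> by (intro convexD)
    then show "g (u *\<^sub>R x + v *\<^sub>R y) \<le> u * g x + v * g y"
      by (rule LIMSEQ_le[OF lim tendsto_add[OF tendsto_mult_left[OF lim] tendsto_mult_left[OF lim]]])
        (use * assms(1) in \<open>auto simp: convex_on_def\<close>)
  qed
qed

lemma ex_antiderivative:
  fixes f :: "real \<Rightarrow> real"
  assumes "continuous_on UNIV f"
  shows "\<exists>F. \<forall>x. DERIV F x :> f x"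
  using einterval_antiderivative[of "-\<infinity>" "\<infinity>" f] assms
  by (simp add: continuous_on_eq_continuous_at has_real_derivative_iff_has_vector_derivative)

lemma continuous_heat:
  assumes "h > 0" and cont: "continuous_on UNIV g" and bd: "\<And>y. \<bar>g y\<bar> \<le> C"
  shows "continuous_on UNIV (heat h g)"
  unfolding continuous_on_sequentially
proof (intro allI ballI impI)
  let ?n = "normal_density 0 (sqrt h)"
  fix X :: "nat \<Rightarrow> real" and x assume X: "(\<forall>i. X i \<in> UNIV) \<and> X \<longlonglongrightarrow> x"
  have [measurable]: "g \<in> borel_measurable borel" using cont by (rule borel_measurable_continuous_onI)
  have "(\<lambda>i. \<integral>z. ?n z * g (X i + z) \<partial>lborel) \<longlonglongrightarrow> (\<integral>z. ?n z * g (x + z) \<partial>lborel)"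
  proof (rule integral_dominated_convergence)
    show "integrable lborel (\<lambda>z. ?n z * C)"
      using \<open>h > 0\<close> by (intro integrable_mult_left integrable_normal_density) simp
    have "(\<lambda>i. g (X i + z)) \<longlonglongrightarrow> g (x + z)" for z
      by (rule continuous_on_tendsto_compose[OF cont]) (use X in \<open>auto intro!: tendsto_intros\<close>)
    then show "AE z in lborel. (\<lambda>i. ?n z * g (X i + z)) \<longlonglongrightarrow> ?n z * g (x + z)"
      by (intro AE_I2 tendsto_intros)
    show "AE z in lborel. norm (?n z * g (X i + z)) \<le> ?n z * C" for i
      by (auto simp: abs_mult intro!: mult_left_mono bd)
  qed measurable
  then show "(heat h g \<circ> X) \<longlonglongrightarrow> heat h g x" by (simp add: heat_def comp_def)
qed

text \<open>Since \<open>p\<close> is nonnegative, its primitive starting at \<open>a\<close>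
  increases from 0 to at most \<open>K\<close>; an L^1 bound on \<open>p\<close> thus becomes a
  Lipschitz bound on the second primitive. The normalisation at \<open>a\<close> and the estimate on
  the closed interval prepare a compactness argument, while two-sided derivatives are claimed in the
  interior only.\<close>

lemma double_antiderivative:
  fixes p :: "real \<Rightarrow> real"
  assumes p: "continuous_on {a..b} p" and "a \<le> b"
    and nonneg: "\<And>x. x \<in> {a..b} \<Longrightarrow> p x \<ge> 0" and K: "integral {a..b} p \<le> K"
  obtains \<Phi> \<Phi>' where
    "\<And>x. x \<in> {a<..<b} \<Longrightarrow> DERIV \<Phi> x :> \<Phi>' x" "\<And>x. x \<in> {a<..<b} \<Longrightarrow> DERIV \<Phi>' x :> p x"
    "\<And>x y. x \<in> {a..b} \<Longrightarrow> y \<in> {a..b} \<Longrightarrow> \<bar>\<Phi> x - \<Phi> y\<bar> \<le> K * \<bar>x - y\<bar>" "\<Phi> a = 0"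
proof -
  define \<Phi>' where "\<Phi>' x = integral {a..x} p" for x
  define \<Phi> where "\<Phi> x = integral {a..x} \<Phi>'" for x
  have d': "(\<Phi>' has_field_derivative p x) (at x within {a..b})" if "x \<in> {a..b}" for x
    unfolding \<Phi>'_def by (rule integral_has_real_derivative[OF p that])
  then have "continuous_on {a..b} \<Phi>'" by (rule DERIV_continuous_on)
  then have d: "(\<Phi> has_field_derivative \<Phi>' x) (at x within {a..b})" if "x \<in> {a..b}" for x
    unfolding \<Phi>_def using integral_has_real_derivative that by blast
  have at: "at x within {a..b} = at x" if "x \<in> {a<..<b}" for x
    using that by (intro at_within_interior) (simp add: interior_atLeastAtMost_real)
  have \<Phi>'_bd: "\<bar>\<Phi>' x\<bar> \<le> K" if x: "x \<in> {a..b}" for x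
  proof -
    have int: "p integrable_on {a..x}" "p integrable_on {a..b}"
      using x by (auto intro!: integrable_continuous_interval continuous_on_subset[OF p])
    have "0 \<le> \<Phi>' x" unfolding \<Phi>'_def using x nonneg by (intro integral_nonneg int) auto
    moreover have "\<Phi>' x \<le> integral {a..b} p"
      unfolding \<Phi>'_def using x nonneg by (intro integral_subset_le int) auto
    ultimately show ?thesis using K by simp
  qed
  show ?thesis
  proof
    show "DERIV \<Phi> x :> \<Phi>' x" "DERIV \<Phi>' x :> p x" if "x \<in> {a<..<b}" for x
      using d[of x] d'[of x] at[OF that] that by auto
    show "\<bar>\<Phi> x - \<Phi> y\<bar> \<le> K * \<bar>x - y\<bar>" if "x \<in> {a..b}" "y \<in> {a..b}" for x y
      using field_differentiable_bound[of "{a..b}" \<Phi> \<Phi>' K x y] d \<Phi>'_bd that by (auto simp: abs_minus_commute)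
    show "\<Phi> a = 0" by (simp add: \<Phi>_def)
  qed
qed

lemma difference_of_convex_from_heat_estimate:
  fixes f :: "real \<Rightarrow> real"
  assumes cont: "continuous_on UNIV f" and bd: "\<And>y. \<bar>f y\<bar> \<le> C"
    and h: "\<And>i. h i > 0" "h \<longlonglongrightarrow> 0" and "r > 0"
    and est: "\<And>i. integral {-r..r} (\<lambda>x. \<bar>heat (h i) f x - f x\<bar>) \<le> K * h i"
  shows "\<exists>g k :: real \<Rightarrow> real. convex_on {-r<..<r} g \<and> convex_on {-r<..<r} k \<and>
           (\<forall>x\<in>{-r<..<r}. f x = g x - k x)"
proof -
  obtain G' where G': "\<And>x. DERIV G' x :> f x" using ex_antiderivative[OF cont] by blast
  then have contG': "continuous_on UNIV G'" by (meson DERIV_continuous_on has_field_derivative_at_within)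
  then obtain G where G: "\<And>x. DERIV G x :> G' x" using ex_antiderivative by blast
  have [measurable]: "f \<in> borel_measurable borel" "G' \<in> borel_measurable borel"
    using cont contG' by (auto intro: borel_measurable_continuous_onI)
  have "C \<ge> 0" using bd[of 0] by simp
  have G'_bd: "\<bar>G' y\<bar> \<le> \<bar>G' 0\<bar> + C * \<bar>y\<bar>" for y
    using abs_increment_le_of_linear_deriv_bound[OF G', of C 0 0 y] bd by (auto simp: mult.commute)
  define \<psi> where "\<psi> i x = 2 / h i * (heat (h i) f x - f x)" for i x
  define u where "u i x = 2 / h i * (heat (h i) G x - G x)" for i x
  define u' where "u' i x = 2 / h i * (heat (h i) G' x - G' x)" for i x
  have u: "DERIV (u i) x :> u' i x" for i x
    unfolding u_def u'_def using \<open>C \<ge> 0\<close>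
    by (intro DERIV_cmult DERIV_diff DERIV_heat[OF h(1) G _ G'_bd] G) auto
  have u': "DERIV (u' i) x :> \<psi> i x" for i x
    unfolding u'_def \<psi>_def
    by (intro DERIV_cmult DERIV_diff DERIV_heat[OF h(1) G', of C 0] G') (auto intro: bd)
  have \<psi>_cont: "continuous_on S (\<psi> i)" for S i
    unfolding \<psi>_def
    by (intro continuous_intros continuous_on_subset[OF cont] continuous_on_subset[OF continuous_heat[OF h(1) cont bd]]) auto
  have pos_cont: "continuous_on S (\<lambda>x. max 0 (\<psi> i x))" for S i
    by (intro continuous_intros \<psi>_cont)
  have est': "integral {-r..r} (\<lambda>x. max 0 (\<psi> i x)) \<le> 2 * K" for i
  proof -
    have "integral {-r..r} (\<lambda>x. max 0 (\<psi> i x)) \<le> integral {-r..r} (\<lambda>x. \<bar>\<psi> i x\<bar>)"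
      by (intro integral_le integrable_continuous_interval continuous_intros \<psi>_cont) auto
    also have "\<dots> = integral {-r..r} (\<lambda>x. 2 / h i * \<bar>heat (h i) f x - f x\<bar>)"
      using h(1)[of i] unfolding \<psi>_def abs_mult by (intro integral_cong) simp
    also have "\<dots> = 2 / h i * integral {-r..r} (\<lambda>x. \<bar>heat (h i) f x - f x\<bar>)"
      by (rule integral_mult_right)
    also have "\<dots> \<le> 2 / h i * (K * h i)" using h(1)[of i] est[of i] by (intro mult_left_mono) auto
    finally show ?thesis using h(1)[of i] by simp
  qed
  have "\<exists>\<Phi> \<Phi>'. (\<forall>x\<in>{-r<..<r}. DERIV \<Phi> x :> \<Phi>' x \<and> DERIV \<Phi>' x :> max 0 (\<psi> i x)) \<and>
     (\<forall>x\<in>{-r..r}. \<forall>y\<in>{-r..r}. \<bar>\<Phi> x - \<Phi> y\<bar> \<le> 2 * K * \<bar>x - y\<bar>) \<and> \<Phi> (-r) = 0" for i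
  proof -
    obtain \<Phi> \<Phi>' where "\<And>x. x \<in> {-r<..<r} \<Longrightarrow> DERIV \<Phi> x :> \<Phi>' x"
      "\<And>x. x \<in> {-r<..<r} \<Longrightarrow> DERIV \<Phi>' x :> max 0 (\<psi> i x)"
      "\<And>x y. x \<in> {-r..r} \<Longrightarrow> y \<in> {-r..r} \<Longrightarrow> \<bar>\<Phi> x - \<Phi> y\<bar> \<le> 2 * K * \<bar>x - y\<bar>" "\<Phi> (-r) = 0"
      by (rule double_antiderivative[OF pos_cont _ _ est']) (use \<open>r > 0\<close> in auto)
    then show ?thesis by blast
  qed
  then obtain \<Phi> \<Phi>' where
    \<Phi>: "\<And>i x. x \<in> {-r<..<r} \<Longrightarrow> DERIV (\<Phi> i) x :> \<Phi>' i x"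
      "\<And>i x. x \<in> {-r<..<r} \<Longrightarrow> DERIV (\<Phi>' i) x :> max 0 (\<psi> i x)"
    and Lip: "\<And>i x y. x \<in> {-r..r} \<Longrightarrow> y \<in> {-r..r} \<Longrightarrow> \<bar>\<Phi> i x - \<Phi> i y\<bar> \<le> 2 * K * \<bar>x - y\<bar>"
    and \<Phi>0: "\<And>i. \<Phi> i (-r) = 0"
    by metis
  \<comment> \<open>The sign of \<open>K\<close> is read off from the Lipschitz bound between the
    two endpoints.\<close>
  have "K \<ge> 0" using Lip[of r "-r" 0] \<open>r > 0\<close> by (smt (verit) atLeastAtMost_iff zero_le_mult_iff)
  obtain g \<rho> where \<rho>: "strict_mono (\<rho> :: nat \<Rightarrow> nat)"
    and conv: "\<And>e. 0 < e \<Longrightarrow> \<exists>N. \<forall>n x. n \<ge> N \<and> x \<in> {-r..r} \<longrightarrow> norm (\<Phi> (\<rho> n) x - g x) < e"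
  proof (rule Arzela_Ascoli[of "{-r..r}" \<Phi> "2 * K * (2 * r)"])
    show "norm (\<Phi> n x) \<le> 2 * K * (2 * r)" if "x \<in> {-r..r}" for n x
    proof -
      have "\<bar>\<Phi> n x\<bar> \<le> 2 * K * \<bar>x - (-r)\<bar>" using Lip[of x "-r" n] that \<Phi>0[of n] by auto
      also have "\<dots> \<le> 2 * K * (2 * r)" using that \<open>K \<ge> 0\<close> by (intro mult_left_mono) auto
      finally show ?thesis by simp
    qed
    fix x e :: real assume x: "x \<in> {-r..r}" and "0 < e"
    show "\<exists>d>0. \<forall>n y. y \<in> {-r..r} \<and> norm (x - y) < d \<longrightarrow> norm (\<Phi> n x - \<Phi> n y) < e"
    \<comment> \<open>The added 1 keeps the denominator positive when \<open>K\<close> is 0.\<close>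
    proof (intro exI[of _ "e / (2 * K + 1)"] conjI allI impI)
      show "0 < e / (2 * K + 1)" using \<open>0 < e\<close> \<open>K \<ge> 0\<close> by simp
      fix n y assume y: "y \<in> {-r..r} \<and> norm (x - y) < e / (2 * K + 1)"
      have "norm (\<Phi> n x - \<Phi> n y) \<le> 2 * K * \<bar>x - y\<bar>" using Lip[of x y n] x y by simp
      also have "\<dots> \<le> (2 * K + 1) * \<bar>x - y\<bar>" by (intro mult_right_mono) auto
      also have "\<dots> < e" using y \<open>K \<ge> 0\<close> by (simp add: field_simps)
      finally show "norm (\<Phi> n x - \<Phi> n y) < e" .
    qed
  qed auto
  have g: "(\<lambda>n. \<Phi> (\<rho> n) x) \<longlonglongrightarrow> g x" if "x \<in> {-r<..<r}" for x
    using conv that by (intro LIMSEQ_I) (metis atLeastAtMost_iff greaterThanLessThan_iff less_imp_le)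
  \<comment> \<open>This convergence holds along the whole sequence, so the subsequence is dictated
    by \<open>\<Phi>\<close> alone.\<close>
  have f: "(\<lambda>n. u (\<rho> n) x) \<longlonglongrightarrow> f x" for x
  proof -
    have "(\<lambda>i. u i x) \<longlonglongrightarrow> f x"
      unfolding u_def by (rule heat_generator_tendsto[OF G G' bd _ h]) (use cont in \<open>simp add: continuous_on_eq_continuous_at\<close>)
    then show ?thesis using LIMSEQ_subseq_LIMSEQ[OF _ \<rho>] by (simp add: comp_def)
  qed
  have "convex_on {-r<..<r} (\<Phi> i)" for i
    by (rule f''_ge0_imp_convex[of _ _ "\<Phi>' i" "\<lambda>x. max 0 (\<psi> i x)"]) (auto intro: \<Phi>)
  then have 1: "convex_on {-r<..<r} g" by (rule convex_on_limit[where F = "\<lambda>n. \<Phi> (\<rho> n)"]) (rule g)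
  \<comment> \<open>The second derivative of this difference is the negative part of
    \<open>\<psi> i\<close>.\<close>
  have "convex_on {-r<..<r} (\<lambda>x. \<Phi> i x - u i x)" for i
    by (rule f''_ge0_imp_convex[where f' = "\<lambda>x. \<Phi>' i x - u' i x" and f'' = "\<lambda>x. max 0 (\<psi> i x) - \<psi> i x"])
      (auto intro!: DERIV_diff \<Phi> u u')
  then have 2: "convex_on {-r<..<r} (\<lambda>x. g x - f x)"
    by (rule convex_on_limit[where F = "\<lambda>n x. \<Phi> (\<rho> n) x - u (\<rho> n) x"]) (intro tendsto_diff g f)
  show ?thesis
    by (rule exI[of _ g], rule exI[of _ "\<lambda>x. g x - f x"]) (use 1 2 in auto)
qed

section \<open>Brownian motion with respect to a filtration\<close>

lemma borel_measurable_heat [measurable]: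
  assumes [measurable]: "g \<in> borel_measurable borel"
  shows "heat h g \<in> borel_measurable borel"
  unfolding heat_def by measurable

lemma integrable_normal_bounded:
  assumes "h > 0" and [measurable]: "g \<in> borel_measurable borel" and "\<And>z. \<bar>g z\<bar> \<le> C"
  shows "integrable lborel (\<lambda>z. normal_density 0 (sqrt h) z * g z)"
  by (rule integrable_normal_polynomial_bound[where a = C and b = 0 and c = 0]) (use assms in auto)

lemma abs_heat_le:
  assumes "h > 0" and [measurable]: "g \<in> borel_measurable borel" and bd: "\<And>z. \<bar>g z\<bar> \<le> C"
  shows "\<bar>heat h g x\<bar> \<le> C"
proof -
  let ?n = "normal_density 0 (sqrt h)"
  have h: "sqrt h > 0" using assms by simp
  have "\<bar>heat h g x\<bar> \<le> (\<integral>z. \<bar>?n z * g (x + z)\<bar> \<partial>lborel)"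
    unfolding heat_def using integral_norm_bound[of lborel "\<lambda>z. ?n z * g (x + z)"] by simp
  also have "\<dots> \<le> (\<integral>z. ?n z * C \<partial>lborel)"
    using bd \<open>h > 0\<close>
    by (intro integral_mono integrable_abs integrable_normal_bounded[OF \<open>h > 0\<close>, of _ C]
        integrable_mult_left integrable_normal_density[OF h])
      (auto simp: abs_mult intro: mult_left_mono)
  also have "\<dots> = C" using integral_normal_density[OF h] by simp
  finally show ?thesis .
qed

text \<open>The Gaussian density is largest at its centre. This bound of the supremum by the
  integral, of order \<open>1 / sqrt h\<close>, is the smoothing on which the second moment estimate
  rests.\<close>

lemma heat_le_integral:
  assumes "h > 0" and g: "integrable lborel g" and nn: "\<And>z. g z \<ge> 0"
  shows "heat h g x \<le> (\<integral>z. g z \<partial>lborel) / sqrt (2 * pi * h)"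
proof -
  let ?n = "normal_density 0 (sqrt h)"
  have n: "?n z \<le> 1 / sqrt (2 * pi * h)" for z
    using \<open>h > 0\<close> by (simp add: normal_density_def divide_right_mono)
  have [measurable]: "g \<in> borel_measurable borel" using g by auto
  have gx: "integrable lborel (\<lambda>z. g (x + z))"
    using lborel_integrable_real_affine[OF g, of 1 x] by simp
  have "heat h g x \<le> (\<integral>z. 1 / sqrt (2 * pi * h) * g (x + z) \<partial>lborel)"
    unfolding heat_def
  proof (rule integral_mono)
    show int: "integrable lborel (\<lambda>z. 1 / sqrt (2 * pi * h) * g (x + z))"
      using gx by (intro integrable_mult_right)
    show le: "?n z * g (x + z) \<le> 1 / sqrt (2 * pi * h) * g (x + z)" for z
      by (intro mult_right_mono n nn)
    show "integrable lborel (\<lambda>z. ?n z * g (x + z))"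
    proof (rule Bochner_Integration.integrable_bound[OF int])
      show "AE z in lborel. norm (?n z * g (x + z)) \<le> norm (1 / sqrt (2 * pi * h) * g (x + z))"
        using nn le \<open>h > 0\<close> by (intro AE_I2) (simp only: real_norm_def abs_of_nonneg mult_nonneg_nonneg
          normal_density_nonneg nn divide_nonneg_nonneg real_sqrt_ge_zero zero_le_one mult_nonneg_nonneg pi_ge_zero less_imp_le zero_le_numeral)
    qed measurable
  qed
  also have "\<dots> = (\<integral>z. g z \<partial>lborel) / sqrt (2 * pi * h)"
    using lborel_integral_real_affine[of 1 g x] by simp
  finally show ?thesis .
qed

text \<open>For \<open>z\<^sup>2 \<le> T\<close> and \<open>T / 2 \<le> h\<close> the Gaussian
  exponent is at least -1, and \<open>h \<le> T\<close> bounds the normalising factor from below.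
  The support condition confines the integrand to this range.\<close>

lemma heat_ge_integral:
  assumes "0 < T" "T / 2 \<le> h" "h \<le> T" and g: "integrable lborel g" and nn: "\<And>z. g z \<ge> 0"
    and bd: "\<And>z. \<bar>g z\<bar> \<le> C" and supp: "\<And>z. z\<^sup>2 > T \<Longrightarrow> g z = 0"
  shows "heat h g 0 \<ge> exp (-1) / sqrt (2 * pi * T) * (\<integral>z. g z \<partial>lborel)"
proof -
  let ?n = "normal_density 0 (sqrt h)"
  have "h > 0" using assms by simp
  have [measurable]: "g \<in> borel_measurable borel" using g by auto
  have n: "exp (-1) / sqrt (2 * pi * T) \<le> ?n z" if "z\<^sup>2 \<le> T" for z
  proof -
    have "exp (-1) / sqrt (2 * pi * T) \<le> exp (-1) / sqrt (2 * pi * h)"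
      using assms \<open>h > 0\<close> by (intro divide_left_mono) auto
    also have "\<dots> \<le> exp (- (z\<^sup>2 / (2 * h))) / sqrt (2 * pi * h)"
      using assms \<open>h > 0\<close> that by (intro divide_right_mono) (auto simp: field_simps)
    also have "\<dots> = ?n z" using \<open>h > 0\<close> by (simp add: normal_density_def)
    finally show ?thesis .
  qed
  have "exp (-1) / sqrt (2 * pi * T) * (\<integral>z. g z \<partial>lborel) = (\<integral>z. exp (-1) / sqrt (2 * pi * T) * g z \<partial>lborel)"
    by simp
  also have "\<dots> \<le> (\<integral>z. ?n z * g z \<partial>lborel)"
  proof (rule integral_mono)
    show "integrable lborel (\<lambda>z. exp (-1) / sqrt (2 * pi * T) * g z)" using g by (intro integrable_mult_right)
    show "integrable lborel (\<lambda>z. ?n z * g z)"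
      by (rule integrable_normal_bounded[OF \<open>h > 0\<close> _ bd]) measurable
    show "exp (-1) / sqrt (2 * pi * T) * g z \<le> ?n z * g z" for z
      using mult_right_mono[OF n nn, of z z] supp[of z] by (cases "z\<^sup>2 \<le> T") auto
  qed
  finally show ?thesis by (simp add: heat_def)
qed

locale filtered_brownian = prob_space M
  for M :: "'a measure" +
  fixes F :: "real \<Rightarrow> 'a measure" and W :: "real \<Rightarrow> 'a \<Rightarrow> real"
  assumes filtration: "filtration_on M F" and brownian: "brownian_motion M F W"
begin

lemma subalgebra_F: "0 \<le> t \<Longrightarrow> subalgebra M (F t)"
  using filtration by (simp add: filtration_on_def)

lemma subalgebra_F_mono: "0 \<le> s \<Longrightarrow> s \<le> t \<Longrightarrow> subalgebra (F t) (F s)"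
  using filtration by (force simp: filtration_on_def subalgebra_def)

lemma measurable_F: "0 \<le> t \<Longrightarrow> X \<in> measurable (F t) N \<Longrightarrow> X \<in> measurable M N"
  using measurable_from_subalg[OF subalgebra_F] by blast

lemma measurable_F_mono: "0 \<le> s \<Longrightarrow> s \<le> t \<Longrightarrow> X \<in> measurable (F s) N \<Longrightarrow> X \<in> measurable (F t) N"
  using measurable_from_subalg[OF subalgebra_F_mono] by blast

lemma space_F: "0 \<le> t \<Longrightarrow> space (F t) = space M"
  using subalgebra_F by (auto simp: subalgebra_def)

lemma sets_F: "0 \<le> t \<Longrightarrow> A \<in> sets (F t) \<Longrightarrow> A \<in> sets M"
  using subalgebra_F by (auto simp: subalgebra_def)

lemma sets_F_mono: "0 \<le> s \<Longrightarrow> s \<le> t \<Longrightarrow> A \<in> sets (F s) \<Longrightarrow> A \<in> sets (F t)"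
  using subalgebra_F_mono by (auto simp: subalgebra_def)

lemma W_adapted: "0 \<le> t \<Longrightarrow> W t \<in> borel_measurable (F t)"
  using brownian by (simp add: brownian_motion_def adapted_def)

lemma W_measurable: "0 \<le> t \<Longrightarrow> W t \<in> borel_measurable M"
  by (rule measurable_F[OF _ W_adapted])

text \<open>Brownian motion is defined by independence of single events. Rectangles generate the
  product sigma-algebra, so uniqueness of the product measure upgrades this to a joint law, for an
  \<open>F s\<close>-measurable \<open>X\<close> with values in any space.\<close>

lemma distr_increment_pair:
  assumes st: "0 \<le> s" "s < t" and X: "X \<in> measurable (F s) N"
  shows "distr M N X \<Otimes>\<^sub>M density lborel (normal_density 0 (sqrt (t - s))) =
    distr M (N \<Otimes>\<^sub>M borel) (\<lambda>\<omega>. (X \<omega>, W t \<omega> - W s \<omega>))"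
proof (rule pair_measure_eqI)
  have [measurable]: "X \<in> measurable M N" "W s \<in> borel_measurable M" "W t \<in> borel_measurable M"
    using st by (auto intro: measurable_F[OF _ X] W_measurable)
  interpret X: prob_space "distr M N X" by (rule prob_space_distr) simp
  interpret Z: prob_space "density lborel (normal_density 0 (sqrt (t - s)))"
    using st by (intro prob_space_normal_density) simp
  show "sigma_finite_measure (distr M N X)" "sigma_finite_measure (density lborel (normal_density 0 (sqrt (t - s))))"
    by unfold_locales
  show "sets (distr M N X \<Otimes>\<^sub>M density lborel (normal_density 0 (sqrt (t - s)))) =
      sets (distr M (N \<Otimes>\<^sub>M borel) (\<lambda>\<omega>. (X \<omega>, W t \<omega> - W s \<omega>)))"
    by (simp cong: sets_pair_measure_cong)
  fix A B assume A: "A \<in> sets (distr M N X)" and B: "B \<in> sets (density lborel (normal_density 0 (sqrt (t - s))))"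
  then have [measurable]: "A \<in> sets N" "B \<in> sets borel" by auto
  have dist: "distributed M lborel (\<lambda>\<omega>. W t \<omega> - W s \<omega>) (\<lambda>x. ennreal (normal_density 0 (sqrt (t - s)) x))"
    and indep: "\<And>A B. A \<in> sets (F s) \<Longrightarrow> B \<in> sets borel \<Longrightarrow> measure M (A \<inter> {\<omega>\<in>space M. W t \<omega> - W s \<omega> \<in> B}) =
           measure M A * measure M {\<omega>\<in>space M. W t \<omega> - W s \<omega> \<in> B}"
    using brownian st by (auto simp: brownian_motion_def)
  have "emeasure (density lborel (normal_density 0 (sqrt (t - s)))) B =
      emeasure (distr M lborel (\<lambda>\<omega>. W t \<omega> - W s \<omega>)) B"
    using distributed_distr_eq_density[OF dist] by simp
  also have "\<dots> = measure M {\<omega>\<in>space M. W t \<omega> - W s \<omega> \<in> B}"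
    by (subst emeasure_distr) (auto simp: emeasure_eq_measure intro!: arg_cong[where f = "measure M"])
  finally have 1: "emeasure (density lborel (normal_density 0 (sqrt (t - s)))) B =
    measure M {\<omega>\<in>space M. W t \<omega> - W s \<omega> \<in> B}" .
  have XA: "X -` A \<inter> space M \<in> sets (F s)"
    using measurable_sets[OF X \<open>A \<in> sets N\<close>] space_F[OF st(1)] by simp
  have "emeasure (distr M (N \<Otimes>\<^sub>M borel) (\<lambda>\<omega>. (X \<omega>, W t \<omega> - W s \<omega>))) (A \<times> B)
      = measure M ((X -` A \<inter> space M) \<inter> {\<omega>\<in>space M. W t \<omega> - W s \<omega> \<in> B})"
    by (subst emeasure_distr) (auto simp: emeasure_eq_measure intro!: arg_cong[where f = "measure M"])
  also have "\<dots> = emeasure (distr M N X) A * emeasure (density lborel (normal_density 0 (sqrt (t - s)))) B"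
    unfolding 1 indep[OF XA \<open>B \<in> sets borel\<close>]
    by (simp add: emeasure_distr emeasure_eq_measure ennreal_mult)
  finally show "emeasure (distr M N X) A * emeasure (density lborel (normal_density 0 (sqrt (t - s)))) B =
     emeasure (distr M (N \<Otimes>\<^sub>M borel) (\<lambda>\<omega>. (X \<omega>, W t \<omega> - W s \<omega>))) (A \<times> B)" by simp
qed

text \<open>The identity \<open>E (g (W t) | F s) = heat (t - s) g (W s)\<close>, tested against
  bounded weights, which is the form in which it is applied. Fubini integrates out the independent
  increment against its normal density.\<close>

lemma markov_property:
  assumes st: "0 \<le> s" "s < t" and Z: "Z \<in> borel_measurable (F s)" "\<And>\<omega>. \<bar>Z \<omega>\<bar> \<le> B"
    and g [measurable]: "g \<in> borel_measurable borel" and g_bd: "\<And>x. \<bar>g x\<bar> \<le> C"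
  shows "(\<integral>\<omega>. Z \<omega> * g (W t \<omega>) \<partial>M) = (\<integral>\<omega>. Z \<omega> * heat (t - s) g (W s \<omega>) \<partial>M)"
proof -
  let ?n = "normal_density 0 (sqrt (t - s))"
  let ?N = "borel \<Otimes>\<^sub>M borel :: (real \<times> real) measure"
  \<comment> \<open>The weight travels with \<open>W s\<close> in one \<open>F s\<close>-measurable
    pair, so that a single joint law covers the whole integrand.\<close>
  let ?X = "\<lambda>\<omega>. (Z \<omega>, W s \<omega>)"
  let ?k = "\<lambda>(p, z). fst p * g (snd p + z)"
  have X: "?X \<in> measurable (F s) ?N" using Z W_adapted[OF st(1)] by measurable
  have [measurable]: "?X \<in> measurable M ?N" "W s \<in> borel_measurable M" "W t \<in> borel_measurable M"
     "Z \<in> borel_measurable M"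
    using st by (auto intro: measurable_F[OF _ X] measurable_F[OF _ Z(1)] W_measurable)
  interpret X: prob_space "distr M ?N ?X" by (rule prob_space_distr) simp
  interpret Y: prob_space "density lborel ?n"
    using st by (intro prob_space_normal_density) simp
  interpret P: pair_sigma_finite "distr M ?N ?X" "density lborel ?n" ..
  have "integrable M (\<lambda>\<omega>. Z \<omega> * g (W t \<omega>))"
    using Z(2) g_bd
    by (intro integrable_const_bound[of _ "B * C"] AE_I2) (auto simp: abs_mult intro!: mult_mono order_trans[OF abs_ge_zero])
  then have "integrable (distr M (?N \<Otimes>\<^sub>M borel) (\<lambda>\<omega>. (?X \<omega>, W t \<omega> - W s \<omega>))) ?k"
    by (subst integrable_distr_eq) simp_all
  then have int: "integrable (distr M ?N ?X \<Otimes>\<^sub>M density lborel ?n) ?k"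
    by (simp add: distr_increment_pair[OF st X])
  have "(\<integral>\<omega>. Z \<omega> * g (W t \<omega>) \<partial>M) = (\<integral>q. ?k q \<partial>distr M (?N \<Otimes>\<^sub>M borel) (\<lambda>\<omega>. (?X \<omega>, W t \<omega> - W s \<omega>)))"
    by (subst integral_distr) simp_all
  also have "\<dots> = (\<integral>p. \<integral>z. ?k (p, z) \<partial>density lborel ?n \<partial>distr M ?N ?X)"
    unfolding distr_increment_pair[OF st X, symmetric] using P.integral_fst'[OF int] by simp
  also have "\<dots> = (\<integral>p. fst p * heat (t - s) g (snd p) \<partial>distr M ?N ?X)"
    by (simp add: integral_real_density heat_def mult.left_commute[of "normal_density _ _ _"])
  also have "\<dots> = (\<integral>\<omega>. Z \<omega> * heat (t - s) g (W s \<omega>) \<partial>M)"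
    by (subst integral_distr) simp_all
  finally show ?thesis .
qed

text \<open>As \<open>W 0\<close> vanishes almost surely, the Markov property at time 0 has the
  constant \<open>heat t g 0\<close> on its right side, and events of \<open>F 0\<close> split off
  as a factor.\<close>

lemma expectation_from_start:
  assumes "0 < t" and D: "D \<in> sets (F 0)"
    and g [measurable]: "g \<in> borel_measurable borel" and g_bd: "\<And>x. \<bar>g x\<bar> \<le> C"
  shows "(\<integral>\<omega>. indicator D \<omega> * g (W t \<omega>) \<partial>M) = measure M D * heat t g 0"
proof -
  have [measurable]: "W 0 \<in> borel_measurable M" "D \<in> sets M" by (auto intro: W_measurable sets_F D)
  have "(\<integral>\<omega>. indicator D \<omega> * g (W t \<omega>) \<partial>M) = (\<integral>\<omega>. indicator D \<omega> * heat (t - 0) g (W 0 \<omega>) \<partial>M)"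
    by (rule markov_property[where B = 1 and C = C]) (use assms in \<open>auto simp: indicator_def\<close>)
  also have "\<dots> = (\<integral>\<omega>. indicator D \<omega> * heat t g 0 \<partial>M)"
    using brownian by (intro integral_cong_AE) (auto simp: brownian_motion_def elim!: eventually_mono)
  finally show ?thesis using \<open>D \<in> sets M\<close> by simp
qed

lemma martingale_integral:
  assumes X: "martingale M F X" and st: "0 \<le> s" "s \<le> t"
    and H: "H \<in> borel_measurable (F s)" "\<And>\<omega>. \<bar>H \<omega>\<bar> \<le> B"
  shows "integrable M (\<lambda>\<omega>. H \<omega> * X t \<omega>)" "(\<integral>\<omega>. H \<omega> * X t \<omega> \<partial>M) = (\<integral>\<omega>. H \<omega> * X s \<omega> \<partial>M)"
proof -
  have X': "integrable M (X t)" "X s \<in> borel_measurable (F s)"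
    "AE \<omega> in M. real_cond_exp M (F s) (X t) \<omega> = X s \<omega>"
    using X st by (auto simp: martingale_def adapted_def)
  have [measurable]: "H \<in> borel_measurable M" "X t \<in> borel_measurable M" "X s \<in> borel_measurable M"
    using measurable_F[OF st(1)] H(1) X' by auto
  interpret sigma_finite_subalgebra M "F s"
    using subalgebra_F[OF st(1)] finite_measure_axioms
    by (intro finite_measure_subalgebra_is_sigma_finite finite_measure_subalgebra.intro finite_measure_subalgebra_axioms.intro)
  show int: "integrable M (\<lambda>\<omega>. H \<omega> * X t \<omega>)"
  proof (rule Bochner_Integration.integrable_bound)
    show "integrable M (\<lambda>\<omega>. B * X t \<omega>)" using X' by simp
    show "AE \<omega> in M. norm (H \<omega> * X t \<omega>) \<le> norm (B * X t \<omega>)"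
      using H(2) by (intro AE_I2) (auto simp: abs_mult intro!: mult_right_mono intro: order_trans[OF _ abs_ge_self])
  qed simp
  have "(\<integral>\<omega>. H \<omega> * X t \<omega> \<partial>M) = (\<integral>\<omega>. H \<omega> * real_cond_exp M (F s) (X t) \<omega> \<partial>M)"
    using real_cond_exp_intg(2)[OF int H(1)] by simp
  also have "\<dots> = (\<integral>\<omega>. H \<omega> * X s \<omega> \<partial>M)"
    using X'(3) by (intro integral_cong_AE) (auto elim!: eventually_mono)
  finally show "(\<integral>\<omega>. H \<omega> * X t \<omega> \<partial>M) = (\<integral>\<omega>. H \<omega> * X s \<omega> \<partial>M)" .
qed

text \<open>\<open>sgn (X s)\<close> is an admissible \<open>F s\<close>-measurable weight; testing
  the martingale with it yields the submartingale inequality for the absolute value.\<close>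

lemma martingale_abs_integral_le:
  assumes X: "martingale M F X" and st: "0 \<le> s" "s \<le> t"
    and H: "H \<in> borel_measurable (F s)" "\<And>\<omega>. 0 \<le> H \<omega>" "\<And>\<omega>. H \<omega> \<le> B"
  shows "(\<integral>\<omega>. H \<omega> * \<bar>X s \<omega>\<bar> \<partial>M) \<le> (\<integral>\<omega>. H \<omega> * \<bar>X t \<omega>\<bar> \<partial>M)"
proof -
  have [measurable]: "X s \<in> borel_measurable (F s)" "H \<in> borel_measurable (F s)"
    using X st H by (auto simp: martingale_def adapted_def)
  have "B \<ge> 0" using H(2,3) order_trans by blast
  let ?H = "\<lambda>\<omega>. H \<omega> * sgn (X s \<omega>)"
  have H': "?H \<in> borel_measurable (F s)" "\<And>\<omega>. \<bar>?H \<omega>\<bar> \<le> B"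
    using H(2,3) \<open>B \<ge> 0\<close> by (measurable, auto simp: abs_mult sgn_if)
  have "(\<integral>\<omega>. H \<omega> * \<bar>X s \<omega>\<bar> \<partial>M) = (\<integral>\<omega>. ?H \<omega> * X s \<omega> \<partial>M)"
    by (simp add: abs_sgn ac_simps)
  also have "\<dots> = (\<integral>\<omega>. ?H \<omega> * X t \<omega> \<partial>M)" by (rule martingale_integral(2)[OF X st H', symmetric])
  also have "\<dots> \<le> (\<integral>\<omega>. H \<omega> * \<bar>X t \<omega>\<bar> \<partial>M)"
  proof (rule integral_mono)
    show "integrable M (\<lambda>\<omega>. ?H \<omega> * X t \<omega>)" by (rule martingale_integral(1)[OF X st H'])
    have "integrable M (\<lambda>\<omega>. H \<omega> * X t \<omega>)"
      using H by (intro martingale_integral(1)[OF X st, of _ B]) auto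
    then have "integrable M (\<lambda>\<omega>. \<bar>H \<omega> * X t \<omega>\<bar>)" by (rule integrable_abs)
    then show "integrable M (\<lambda>\<omega>. H \<omega> * \<bar>X t \<omega>\<bar>)" using H(2) by (simp add: abs_mult)
    fix \<omega>
    show "?H \<omega> * X t \<omega> \<le> H \<omega> * \<bar>X t \<omega>\<bar>"
      unfolding mult.assoc by (intro mult_left_mono H(2)) (auto simp: sgn_if)
  qed
  finally show ?thesis .
qed

end

section \<open>Sign changes of Brownian motion at time zero\<close>

lemma (in prob_space) AE_exists_in_positive_set:
  assumes "AE \<omega> in M. P \<omega>" "S \<in> sets M" "measure M S > 0"
  shows "\<exists>\<omega>\<in>S. P \<omega>"
proof (rule ccontr)
  assume "\<not> ?thesis"
  with assms(1) have "AE \<omega> in M. \<omega> \<in> S \<longleftrightarrow> \<omega> \<in> {}" by (auto elim!: eventually_mono)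
  then have "measure M S = measure M {}" using assms(2) by (intro finite_measure_eq_AE) auto
  with assms(3) show False by simp
qed

text \<open>Brownian scaling: on an interval of length \<open>sqrt h\<close> within distance
  \<open>2 * sqrt h\<close> of 0 the density is at least
  \<open>exp (-2) / sqrt (2 * pi * h)\<close>, so the resulting bound does not depend on
  \<open>h\<close>.\<close>

lemma heat_ge_of_ge_1_on_interval:
  assumes "h > 0" and [measurable]: "g \<in> borel_measurable borel" and nn: "\<And>z. g z \<ge> 0"
    and bd: "\<And>z. \<bar>g z\<bar> \<le> C" and one: "\<And>z. a < z \<Longrightarrow> z < a + sqrt h \<Longrightarrow> g (x + z) \<ge> 1"
    and a: "- 2 * sqrt h \<le> a" "a \<le> sqrt h"
  shows "heat h g x \<ge> exp (-2) / sqrt (2 * pi)"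
proof -
  let ?n = "normal_density 0 (sqrt h)" and ?I = "{a<..<a + sqrt h}"
  let ?c = "exp (-2) / sqrt (2 * pi * h)"
  have "exp (-2) / sqrt (2 * pi) = ?c * sqrt h"
    using \<open>h > 0\<close> by (simp add: real_sqrt_mult)
  also have "\<dots> = (\<integral>z. ?c * indicator ?I z \<partial>lborel)" using \<open>h > 0\<close> by simp
  also have "\<dots> \<le> heat h g x"
    unfolding heat_def
  proof (rule integral_mono)
    show "integrable lborel (\<lambda>z. ?c * indicator ?I z)" using \<open>h > 0\<close> by (intro integrable_mult_right) simp
    show "integrable lborel (\<lambda>z. ?n z * g (x + z))"
      by (rule integrable_normal_bounded[OF \<open>h > 0\<close> _ bd]) measurable
    fix z
    show "?c * indicator ?I z \<le> ?n z * g (x + z)"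
    proof (cases "z \<in> ?I")
      case True
      then have "\<bar>z\<bar> \<le> \<bar>2 * sqrt h\<bar>" using a \<open>h > 0\<close> by auto
      then have "z\<^sup>2 \<le> (2 * sqrt h)\<^sup>2" by (simp only: abs_le_square_iff)
      then have "z\<^sup>2 \<le> 4 * h" using \<open>h > 0\<close> by (simp add: power_mult_distrib)
      then have "?c \<le> ?n z"
        using \<open>h > 0\<close> by (auto simp: normal_density_def field_simps intro!: divide_right_mono)
      also have "?n z * 1 \<le> ?n z * g (x + z)" using one True by (intro mult_left_mono) auto
      finally show ?thesis using True by simp
    qed (simp add: nn)
  qed
  finally show ?thesis .
qed

context filtered_brownian begin

text \<open>From 0 the path may land between \<open>- sqrt s\<close> and 0 at time \<open>s\<close>,
  and from there an increment between \<open>sqrt s\<close> and \<open>2 * sqrt s\<close> makes it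
  positive. Each of the two moves has probability at least \<open>exp (-2) / sqrt (2 * pi)\<close>
  at every scale \<open>s\<close>, which is what allows \<open>s\<close> to tend to 0.\<close>

lemma prob_sign_change_ge:
  assumes "0 < s" and D: "D \<in> sets (F 0)"
  shows "measure M (D \<inter> {\<omega>\<in>space M. W s \<omega> < 0 \<and> 0 < W (2 * s) \<omega>}) \<ge> (exp (-2) / sqrt (2 * pi))\<^sup>2 * measure M D"
proof -
  let ?c = "exp (-2) / sqrt (2 * pi) :: real"
  let ?I = "indicator {- sqrt s..<0} :: real \<Rightarrow> real" and ?J = "indicator {0<..} :: real \<Rightarrow> real"
  have [measurable]: "D \<in> sets M" "W s \<in> borel_measurable M" "W (2 * s) \<in> borel_measurable M"
    using assms by (auto intro: W_measurable sets_F)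
  have [measurable]: "D \<in> sets (F s)" "W s \<in> borel_measurable (F s)"
    using assms by (auto intro: sets_F_mono[OF _ _ D] W_adapted)
  have int: "integrable M (\<lambda>\<omega>. indicator D \<omega> * ?I (W s \<omega>))"
    by (rule integrable_const_bound[of _ 1]) (auto simp: indicator_def)
  have J: "heat s ?J x \<ge> ?c" if "x \<in> {- sqrt s..<0}" for x
    by (rule heat_ge_of_ge_1_on_interval[where C = 1 and a = "sqrt s"]) (use assms that in \<open>auto simp: indicator_def\<close>)
  have I: "heat s ?I 0 \<ge> ?c"
    by (rule heat_ge_of_ge_1_on_interval[where C = 1 and a = "- sqrt s"]) (use assms in \<open>auto simp: indicator_def\<close>)
  have "?c\<^sup>2 * measure M D \<le> ?c * (measure M D * heat s ?I 0)"
    using mult_left_mono[OF mult_left_mono[OF I measure_nonneg], of ?c M D] by (simp add: power2_eq_square ac_simps)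
  also have "measure M D * heat s ?I 0 = (\<integral>\<omega>. indicator D \<omega> * ?I (W s \<omega>) \<partial>M)"
    by (rule expectation_from_start[symmetric, where C = 1]) (use assms in \<open>auto simp: indicator_def\<close>)
  also have "?c * \<dots> = (\<integral>\<omega>. (indicator D \<omega> * ?I (W s \<omega>)) * ?c \<partial>M)" by simp
  also have "\<dots> \<le> (\<integral>\<omega>. (indicator D \<omega> * ?I (W s \<omega>)) * heat (2 * s - s) ?J (W s \<omega>) \<partial>M)"
  proof (rule integral_mono)
    show "integrable M (\<lambda>\<omega>. (indicator D \<omega> * ?I (W s \<omega>)) * ?c)" using int by simp
    have "\<bar>heat s ?J x\<bar> \<le> 1" for x using \<open>0 < s\<close> by (intro abs_heat_le) (auto simp: indicator_def)
    then show "integrable M (\<lambda>\<omega>. (indicator D \<omega> * ?I (W s \<omega>)) * heat (2 * s - s) ?J (W s \<omega>))"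
      by (intro integrable_const_bound[of _ 1]) (auto simp: indicator_def)
    show "(indicator D \<omega> * ?I (W s \<omega>)) * ?c \<le> (indicator D \<omega> * ?I (W s \<omega>)) * heat (2 * s - s) ?J (W s \<omega>)" for \<omega>
      using J[of "W s \<omega>"] by (auto simp: indicator_def)
  qed
  also have "\<dots> = (\<integral>\<omega>. (indicator D \<omega> * ?I (W s \<omega>)) * ?J (W (2 * s) \<omega>) \<partial>M)"
    by (rule markov_property[symmetric, where B = 1 and C = 1]) (use assms in \<open>auto simp: indicator_def\<close>)
  also have "\<dots> \<le> (\<integral>\<omega>. indicator (D \<inter> {\<omega>\<in>space M. W s \<omega> < 0 \<and> 0 < W (2 * s) \<omega>}) \<omega> \<partial>M)"
  proof (rule integral_mono)
    show "integrable M (\<lambda>\<omega>. (indicator D \<omega> * ?I (W s \<omega>)) * ?J (W (2 * s) \<omega>))"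
      by (intro integrable_const_bound[of _ 1]) (auto simp: indicator_def)
    show "integrable M (indicator (D \<inter> {\<omega>\<in>space M. W s \<omega> < 0 \<and> 0 < W (2 * s) \<omega>}) :: 'a \<Rightarrow> real)"
      by (rule integrable_const_bound[of _ 1]) auto
    show "\<omega> \<in> space M \<Longrightarrow> (indicator D \<omega> * ?I (W s \<omega>)) * ?J (W (2 * s) \<omega>) \<le>
        indicator (D \<inter> {\<omega>\<in>space M. W s \<omega> < 0 \<and> 0 < W (2 * s) \<omega>}) \<omega>" for \<omega>
      by (auto simp: indicator_def)
  qed
  finally show ?thesis by simp
qed

text \<open>Continuity from above passes the scale-independent bound to the event that sign changes
  occur at arbitrarily small times. Positive probability suffices, because only one path will be
  chosen from it.\<close>

lemma sign_changes_infinitely_often_measure_pos: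
  assumes D: "D \<in> sets (F 0)" and "measure M D > 0"
  defines "E \<equiv> \<lambda>j. {\<omega>\<in>space M. W ((1/2) ^ Suc j) \<omega> < 0 \<and> 0 < W ((1/2) ^ j) \<omega>}"
  shows "(\<Inter>J. D \<inter> (\<Union>j\<in>{J..}. E j)) \<in> sets M" "measure M (\<Inter>J. D \<inter> (\<Union>j\<in>{J..}. E j)) > 0"
proof -
  have [measurable]: "D \<in> sets M" "W ((1/2) ^ j) \<in> borel_measurable M" for j
    by (auto intro: W_measurable sets_F[OF _ D])
  have [measurable]: "E j \<in> sets M" for j unfolding E_def by measurable
  let ?A = "\<lambda>J. D \<inter> (\<Union>j\<in>{J..}. E j)"
  show "(\<Inter>J. ?A J) \<in> sets M" by measurable
  let ?c = "(exp (-2) / sqrt (2 * pi))\<^sup>2 * measure M D"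
  have "?c \<le> measure M (?A J)" for J
  proof -
    have "?c \<le> measure M (D \<inter> E J)"
      using prob_sign_change_ge[OF _ D, of "(1/2) ^ Suc J"] by (simp add: E_def)
    also have "\<dots> \<le> measure M (?A J)" by (intro finite_measure_mono) auto
    finally show ?thesis .
  qed
  moreover have "(\<lambda>J. measure M (?A J)) \<longlonglongrightarrow> measure M (\<Inter>J. ?A J)"
    by (intro finite_Lim_measure_decseq) (auto simp: decseq_def, meson atLeast_iff order_trans)
  ultimately have "?c \<le> measure M (\<Inter>J. ?A J)" by (intro LIMSEQ_le_const) auto
  moreover have "?c > 0" using assms(2) by simp
  ultimately show "measure M (\<Inter>J. ?A J) > 0" by linarith
qed

lemma stopping_time_measurable:
  assumes "stopping_time_on M F T" "0 \<le> t"
  shows "{\<omega>\<in>space M. T \<omega> \<le> ennreal t} \<in> sets (F t)" "{\<omega>\<in>space M. ennreal t < T \<omega>} \<in> sets (F t)"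
proof -
  show *: "{\<omega>\<in>space M. T \<omega> \<le> ennreal t} \<in> sets (F t)"
    using assms by (simp add: stopping_time_on_def)
  have "{\<omega>\<in>space M. ennreal t < T \<omega>} = space (F t) - {\<omega>\<in>space M. T \<omega> \<le> ennreal t}"
    using space_F[OF assms(2)] by auto
  then show "{\<omega>\<in>space M. ennreal t < T \<omega>} \<in> sets (F t)" using * by auto
qed

lemma isCont_near_0_of_cadlag_stopped:
  assumes \<tau>: "stopping_time_on M F \<tau>" "measure M {\<omega>\<in>space M. 0 < \<tau> \<omega>} > 0"
    and cadlag: "AE \<omega> in M. cadlag (\<lambda>t. f (stopped W \<tau> t \<omega>))"
  shows "\<exists>d>0. \<forall>x. \<bar>x\<bar> < d \<longrightarrow> isCont f x"
proof -
  let ?D = "{\<omega>\<in>space M. 0 < \<tau> \<omega>}"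
  let ?E = "\<lambda>j. {\<omega>\<in>space M. W ((1/2) ^ Suc j) \<omega> < 0 \<and> 0 < W ((1/2) ^ j) \<omega>}"
  have "?D \<in> sets (F 0)" using stopping_time_measurable(2)[OF \<tau>(1), of 0] by simp
  note S = sign_changes_infinitely_often_measure_pos[OF this \<tau>(2)]
  have "AE \<omega> in M. continuous_on {0..} (\<lambda>t. W t \<omega>) \<and> cadlag (\<lambda>t. f (stopped W \<tau> t \<omega>))"
    using cadlag brownian by (auto simp: brownian_motion_def)
  \<comment> \<open>Continuity of \<open>f\<close> is a deterministic statement, so one path with
    all almost sure properties and with sign changes at arbitrarily small times decides it.\<close>
  from AE_exists_in_positive_set[OF this S] obtain \<omega> where
    cont: "continuous_on {0..} (\<lambda>t. W t \<omega>)" and rc: "cadlag (\<lambda>t. f (stopped W \<tau> t \<omega>))"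
    and "\<tau> \<omega> > 0" and io: "\<And>J. \<exists>j\<ge>J. \<omega> \<in> ?E j"
    by fastforce
  have "(\<lambda>J. ennreal ((1/2) ^ J)) \<longlonglongrightarrow> ennreal 0" by (intro tendsto_ennrealI LIMSEQ_realpow_zero) auto
  then have "\<forall>\<^sub>F J in sequentially. ennreal ((1/2) ^ J) < \<tau> \<omega>" using \<open>\<tau> \<omega> > 0\<close> by (intro order_tendstoD) auto
  then obtain J where J: "ennreal ((1/2) ^ J) < \<tau> \<omega>" by (auto simp: eventually_sequentially)
  obtain j where j: "j \<ge> J" "\<omega> \<in> ?E j" using io by blast
  \<comment> \<open>The gap of 2 puts the positive value at \<open>s1 \<le> s3 / 4\<close> before
    the negative value at \<open>s2 = s3 / 2\<close>.\<close>
  obtain i where i: "i \<ge> j + 2" "\<omega> \<in> ?E i" using io by blast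
  define s1 s2 s3 :: real where "s1 = (1/2) ^ i" and "s2 = (1/2) ^ Suc j" and "s3 = (1/2) ^ j"
  have s: "0 < s1" "s1 < s2" "s2 < s3"
  proof -
    have "s1 \<le> (1/2) ^ (j + 2)" unfolding s1_def using i(1) by (rule power_decreasing) auto
    moreover have "0 < s1" "0 < s3" "s2 = s3 / 2" "(1/2 :: real) ^ (j + 2) = s3 / 4"
      by (simp_all add: s1_def s2_def s3_def)
    ultimately show "0 < s1" "s1 < s2" "s2 < s3" by linarith+
  qed
  have "s3 \<le> (1/2) ^ J" unfolding s3_def using j(1) by (intro power_decreasing) auto
  then have s3: "ennreal s3 < \<tau> \<omega>" using J by (meson ennreal_leI le_less_trans)
  have stop: "stopped W \<tau> u \<omega> = W u \<omega>" if "u \<le> s3" for u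
    using s3 ennreal_leI[OF that] unfolding stopped_def by (auto dest: less_le_trans)
  have W: "W s1 \<omega> > 0" "W s2 \<omega> < 0" "W s3 \<omega> > 0" using i(2) j(2) by (auto simp: s1_def s2_def s3_def)
  have rc': "((\<lambda>u. f (W u \<omega>)) \<longlongrightarrow> f (W u \<omega>)) (at_right u)" if "s1 \<le> u" "u < s3" for u
  proof -
    have "((\<lambda>u. f (stopped W \<tau> u \<omega>)) \<longlongrightarrow> f (stopped W \<tau> u \<omega>)) (at_right u)"
      using rc that s unfolding cadlag_def by auto
    moreover have "\<forall>\<^sub>F v in at_right u. f (stopped W \<tau> v \<omega>) = f (W v \<omega>)"
      unfolding eventually_at_right_field using that stop by (intro exI[of _ s3]) auto
    ultimately show ?thesis using stop[of u] that by (auto simp: tendsto_cong)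
  qed
  show ?thesis
  proof (intro exI[of _ "min (W s1 \<omega>) (min (- W s2 \<omega>) (W s3 \<omega>))"] conjI allI impI)
    show "0 < min (W s1 \<omega>) (min (- W s2 \<omega>) (W s3 \<omega>))" using W by simp
    fix x assume "\<bar>x\<bar> < min (W s1 \<omega>) (min (- W s2 \<omega>) (W s3 \<omega>))"
    then show "isCont f x"
      by (intro isCont_of_alternating_path[where w = "\<lambda>t. W t \<omega>" and ?s1.0 = s1 and ?s2.0 = s2 and ?s3.0 = s3])
        (use s rc' in \<open>auto intro: continuous_on_subset[OF cont]\<close>)
  qed
qed

end

section \<open>A discrete quasimartingale estimate\<close>

text \<open>The indices \<open>k\<close> with \<open>x\<close> in \<open>G (Suc k)\<close> form an
  initial segment, so the sum is a partial sum of \<open>a\<close> up to an index at which the bound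
  by \<open>K\<close> is available.\<close>

lemma sum_mono_on_decreasing_indicator_le:
  fixes a :: "nat \<Rightarrow> real"
  assumes "\<And>i. a i \<ge> 0" and dec: "\<And>k. x \<in> G (Suc k) \<Longrightarrow> x \<in> G k"
    and "\<And>k. x \<in> G k \<Longrightarrow> (\<Sum>i<k. a i) \<le> K" and "K \<ge> 0"
  shows "(\<Sum>k<n. indicator (G (Suc k)) x * a k) \<le> K"
proof -
  \<comment> \<open>The second conjunct strengthens the induction: as long as \<open>x\<close> stays
    in the sets, the bound by \<open>K\<close> is obtained through it.\<close>
  have "(\<Sum>k<n. indicator (G (Suc k)) x * a k) \<le> K \<and> (\<Sum>k<n. indicator (G (Suc k)) x * a k) \<le> (\<Sum>i<n. a i)" for n
  proof (induction n)
    case (Suc n)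
    show ?case
    proof (cases "x \<in> G (Suc n)")
      case True
      with Suc assms(3)[of "Suc n"] show ?thesis by auto
    next
      case False
      with Suc assms(1)[of n] show ?thesis by auto
    qed
  qed (use \<open>K \<ge> 0\<close> in simp)
  then show ?thesis by blast
qed

context filtered_brownian begin

text \<open>Only the last increment before leaving the sets G k is not an increment of the decomposition.
  There A is not estimated: X before that increment is expressed through R and A, and X after it is
  controlled as a martingale at a stopping time. This avoids any bound on the jumps of A.\<close>

lemma discrete_quasimartingale_bound:
  fixes t :: "nat \<Rightarrow> real" and H R A :: "nat \<Rightarrow> 'a \<Rightarrow> real"
  assumes t: "\<And>k. 0 \<le> t k" "mono t" and X: "martingale M F X"
    and G: "\<And>k. G k \<in> sets (F (t k))" "\<And>k. G (Suc k) \<subseteq> G k" "G N = {}"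
    and H: "\<And>k. H k \<in> borel_measurable (F (t k))" "\<And>k \<omega>. \<bar>H k \<omega>\<bar> \<le> indicator (G k) \<omega>"
    and R: "\<And>k. R k \<in> borel_measurable M" "\<And>k \<omega>. \<bar>R k \<omega>\<bar> \<le> C"
    and "K \<ge> 0"
    and dec: "AE \<omega> in M. \<forall>k. \<omega> \<in> G k \<longrightarrow> R k \<omega> = R 0 \<omega> + X (t k) \<omega> + A k \<omega> \<and> A 0 \<omega> = 0 \<and>
                 (\<Sum>i<k. \<bar>A (Suc i) \<omega> - A i \<omega>\<bar>) \<le> K"
  shows "(\<integral>\<omega>. (\<Sum>k<N. H k \<omega> * (R (Suc k) \<omega> - R k \<omega>)) \<partial>M) \<le> 4 * C + 2 * K + (\<integral>\<omega>. \<bar>X (t N) \<omega>\<bar> \<partial>M)"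
proof -
  let ?i = "\<lambda>k. indicator (G k) :: 'a \<Rightarrow> real"
  let ?d = "\<lambda>k \<omega>. ?i k \<omega> - ?i (Suc k) \<omega>"
  have "C \<ge> 0" using R(2)[of 0 undefined] by simp
  have tS: "t k \<le> t (Suc k)" for k using t(2) by (rule incseq_SucD)
  have GF: "?i k \<in> borel_measurable (F (t k))" for k using G(1) by simp
  have GF': "?i k \<in> borel_measurable (F (t (Suc k)))" for k
    by (rule measurable_F_mono[OF t(1) tS GF])
  have dF: "?d k \<in> borel_measurable (F (t (Suc k)))" for k using GF' GF by simp
  have d01: "0 \<le> ?d k \<omega>" "?d k \<omega> \<le> 1" for k \<omega> using G(2)[of k] by (auto simp: indicator_def)
  have H1: "\<bar>H k \<omega>\<bar> \<le> 1" for k \<omega> by (rule order_trans[OF H(2)]) (simp add: indicator_def)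
  have [measurable]: "H k \<in> borel_measurable M" "?i k \<in> borel_measurable M" "R k \<in> borel_measurable M" for k
    using R(1) measurable_F[OF t(1) H(1)] measurable_F[OF t(1) GF] by auto
  have Xint: "integrable M (X (t k))" for k using X t by (auto simp: martingale_def)
  then have [measurable]: "X (t k) \<in> borel_measurable M" for k by auto
  have HX: "integrable M (\<lambda>\<omega>. H k \<omega> * X (t k) \<omega>)" "integrable M (\<lambda>\<omega>. H k \<omega> * X (t (Suc k)) \<omega>)"
    "(\<integral>\<omega>. H k \<omega> * X (t (Suc k)) \<omega> \<partial>M) = (\<integral>\<omega>. H k \<omega> * X (t k) \<omega> \<partial>M)" for k
    by (auto intro!: martingale_integral[OF X t(1) _ H(1) H1] tS)
  have dX: "integrable M (\<lambda>\<omega>. ?d k \<omega> * \<bar>X (t j) \<omega>\<bar>)" for k j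
  proof (rule Bochner_Integration.integrable_bound[OF Xint[of j]])
    show "AE \<omega> in M. norm (?d k \<omega> * \<bar>X (t j) \<omega>\<bar>) \<le> norm (X (t j) \<omega>)"
      unfolding real_norm_def abs_mult abs_abs abs_of_nonneg[OF d01(1)]
      by (intro AE_I2 mult_left_le_one_le d01 abs_ge_zero)
  qed simp
  \<comment> \<open>\<open>?d k\<close> indicates an exit between steps \<open>k\<close> and
    \<open>Suc k\<close> and is known at time \<open>t (Suc k)\<close>. The submartingale inequality
    therefore moves the value of \<open>X\<close> at the exit to the terminal time.\<close>
  have dXle: "(\<integral>\<omega>. ?d k \<omega> * \<bar>X (t (Suc k)) \<omega>\<bar> \<partial>M) \<le> (\<integral>\<omega>. ?d k \<omega> * \<bar>X (t N) \<omega>\<bar> \<partial>M)" if "k < N" for k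
    using that t(1) d01 by (intro martingale_abs_integral_le[OF X _ _ dF]) (auto intro!: incseqD[OF t(2)])
  \<comment> \<open>There is at most one exit, so the terminal values add up to no more than one
    copy of \<bar>X (t N)\<bar>.\<close>
  have tele: "(\<Sum>k<N. ?d k \<omega>) \<le> 1" for \<omega>
    by (subst sum_lessThan_telescope') (auto simp: G(3) indicator_def)
  have pathwise: "AE \<omega> in M. (\<Sum>k<N. H k \<omega> * (R (Suc k) \<omega> - R k \<omega>)) \<le>
     (\<Sum>k<N. H k \<omega> * X (t (Suc k)) \<omega> - H k \<omega> * X (t k) \<omega>) + (\<Sum>k<N. ?d k \<omega> * \<bar>X (t (Suc k)) \<omega>\<bar>) + (4 * C + 2 * K)"
    using dec
  proof eventually_elim
    case (elim \<omega>)
    let ?a = "\<lambda>k. \<bar>A (Suc k) \<omega> - A k \<omega>\<bar>"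
    \<comment> \<open>The exit term carries \<open>4 * C + K\<close>; the other \<open>K\<close> in
      the final bound is the variation of \<open>A\<close> accumulated before the exit.\<close>
    have step: "H k \<omega> * (R (Suc k) \<omega> - R k \<omega>) \<le> (H k \<omega> * X (t (Suc k)) \<omega> - H k \<omega> * X (t k) \<omega>) +
        ?i (Suc k) \<omega> * ?a k + ?d k \<omega> * \<bar>X (t (Suc k)) \<omega>\<bar> + ?d k \<omega> * (4 * C + K)" for k
    proof (cases "\<omega> \<in> G k")
      case False
      then have "H k \<omega> = 0" "\<omega> \<notin> G (Suc k)" using H(2)[of k \<omega>] G(2) by auto
      with False show ?thesis by simp
    next
      case k: True
      have hb: "H k \<omega> * y \<le> \<bar>y\<bar>" for y
        using mult_right_mono[OF H1[of k \<omega>], of "\<bar>y\<bar>"] by (simp flip: abs_mult)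
      show ?thesis
      proof (cases "\<omega> \<in> G (Suc k)")
        case True
        then have "R (Suc k) \<omega> - R k \<omega> = X (t (Suc k)) \<omega> - X (t k) \<omega> + (A (Suc k) \<omega> - A k \<omega>)"
          using elim k by (auto simp del: sum.lessThan_Suc)
        then have "H k \<omega> * (R (Suc k) \<omega> - R k \<omega>) =
            (H k \<omega> * X (t (Suc k)) \<omega> - H k \<omega> * X (t k) \<omega>) + H k \<omega> * (A (Suc k) \<omega> - A k \<omega>)"
          by (simp only: distrib_left right_diff_distrib)
        then show ?thesis using hb[of "A (Suc k) \<omega> - A k \<omega>"] True k by simp
      next
        case False
        have "\<bar>A k \<omega>\<bar> \<le> (\<Sum>i<k. ?a i)"
        proof -
          have "A 0 \<omega> = 0" using elim k by blast
          then have "A k \<omega> = (\<Sum>i<k. A (Suc i) \<omega> - A i \<omega>)"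
            using sum_lessThan_telescope[of "\<lambda>i. A i \<omega>" k] by simp
          then show ?thesis by (simp only: sum_abs)
        qed
        then have "\<bar>A k \<omega>\<bar> \<le> K" using elim k by force
        moreover have "X (t k) \<omega> = R k \<omega> - R 0 \<omega> - A k \<omega>" using elim k by simp
        ultimately have "\<bar>R (Suc k) \<omega> - R k \<omega> - X (t (Suc k)) \<omega> + X (t k) \<omega>\<bar> \<le> 4 * C + K + \<bar>X (t (Suc k)) \<omega>\<bar>"
          using R(2)[of k \<omega>] R(2)[of "Suc k" \<omega>] R(2)[of 0 \<omega>] by linarith
        moreover have "H k \<omega> * (R (Suc k) \<omega> - R k \<omega>) = (H k \<omega> * X (t (Suc k)) \<omega> - H k \<omega> * X (t k) \<omega>) +
            H k \<omega> * (R (Suc k) \<omega> - R k \<omega> - X (t (Suc k)) \<omega> + X (t k) \<omega>)"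
          by (simp add: algebra_simps)
        ultimately show ?thesis
          using hb[of "R (Suc k) \<omega> - R k \<omega> - X (t (Suc k)) \<omega> + X (t k) \<omega>"] False k by simp
      qed
    qed
    have "(\<Sum>k<N. H k \<omega> * (R (Suc k) \<omega> - R k \<omega>)) \<le> (\<Sum>k<N. (H k \<omega> * X (t (Suc k)) \<omega> - H k \<omega> * X (t k) \<omega>) +
        ?i (Suc k) \<omega> * ?a k + ?d k \<omega> * \<bar>X (t (Suc k)) \<omega>\<bar> + ?d k \<omega> * (4 * C + K))"
      by (intro sum_mono step)
    also have "\<dots> = (\<Sum>k<N. H k \<omega> * X (t (Suc k)) \<omega> - H k \<omega> * X (t k) \<omega>) + (\<Sum>k<N. ?i (Suc k) \<omega> * ?a k) +
        (\<Sum>k<N. ?d k \<omega> * \<bar>X (t (Suc k)) \<omega>\<bar>) + (\<Sum>k<N. ?d k \<omega>) * (4 * C + K)"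
      by (simp only: sum.distrib sum_distrib_right)
    finally have "(\<Sum>k<N. H k \<omega> * (R (Suc k) \<omega> - R k \<omega>)) \<le> \<dots>" .
    moreover have "(\<Sum>k<N. ?i (Suc k) \<omega> * ?a k) \<le> K"
      using elim G(2) \<open>K \<ge> 0\<close> by (intro sum_mono_on_decreasing_indicator_le) auto
    moreover have "(\<Sum>k<N. ?d k \<omega>) * (4 * C + K) \<le> 4 * C + K"
      using mult_right_mono[OF tele[of \<omega>], of "4 * C + K"] \<open>K \<ge> 0\<close> \<open>C \<ge> 0\<close> by simp
    ultimately show ?case by linarith
  qed
  have "integrable M (\<lambda>\<omega>. H k \<omega> * (R (Suc k) \<omega> - R k \<omega>))" for k
  proof (rule integrable_const_bound[of _ "1 * (2 * C)"])
    have "\<bar>R (Suc k) \<omega> - R k \<omega>\<bar> \<le> 2 * C" for \<omega> using R(2)[of k \<omega>] R(2)[of "Suc k" \<omega>] by linarith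
    then show "AE \<omega> in M. norm (H k \<omega> * (R (Suc k) \<omega> - R k \<omega>)) \<le> 1 * (2 * C)"
      using H1 unfolding real_norm_def abs_mult by (intro AE_I2 mult_mono) auto
  qed simp
  then have "(\<integral>\<omega>. (\<Sum>k<N. H k \<omega> * (R (Suc k) \<omega> - R k \<omega>)) \<partial>M) \<le>
     (\<integral>\<omega>. (\<Sum>k<N. H k \<omega> * X (t (Suc k)) \<omega> - H k \<omega> * X (t k) \<omega>) + (\<Sum>k<N. ?d k \<omega> * \<bar>X (t (Suc k)) \<omega>\<bar>) + (4 * C + 2 * K) \<partial>M)"
    by (intro integral_mono_AE pathwise Bochner_Integration.integrable_add Bochner_Integration.integrable_sum
        Bochner_Integration.integrable_diff HX dX integrable_const)
  \<comment> \<open>Martingale increments weighted by the past-measurable \<open>H k\<close> have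
    mean zero and drop out.\<close>
  also have "\<dots> = (\<Sum>k<N. \<integral>\<omega>. ?d k \<omega> * \<bar>X (t (Suc k)) \<omega>\<bar> \<partial>M) + (4 * C + 2 * K)"
    using HX dX by (simp add: prob_space)
  also have "\<dots> \<le> (\<Sum>k<N. \<integral>\<omega>. ?d k \<omega> * \<bar>X (t N) \<omega>\<bar> \<partial>M) + (4 * C + 2 * K)"
    by (intro add_right_mono sum_mono dXle) simp
  also have "(\<Sum>k<N. \<integral>\<omega>. ?d k \<omega> * \<bar>X (t N) \<omega>\<bar> \<partial>M) = (\<integral>\<omega>. (\<Sum>k<N. ?d k \<omega>) * \<bar>X (t N) \<omega>\<bar> \<partial>M)"
    unfolding sum_distrib_right using dX by (intro Bochner_Integration.integral_sum[symmetric])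
  also have "\<dots> \<le> (\<integral>\<omega>. \<bar>X (t N) \<omega>\<bar> \<partial>M)"
  proof (rule integral_mono)
    show "integrable M (\<lambda>\<omega>. (\<Sum>k<N. ?d k \<omega>) * \<bar>X (t N) \<omega>\<bar>)"
      unfolding sum_distrib_right using dX by (intro Bochner_Integration.integrable_sum)
    show "(\<Sum>k<N. ?d k \<omega>) * \<bar>X (t N) \<omega>\<bar> \<le> \<bar>X (t N) \<omega>\<bar>" for \<omega>
      using mult_right_mono[OF tele abs_ge_zero] by simp
  qed (use Xint in simp)
  finally show ?thesis by simp
qed

end

section \<open>Moments of occupation sums\<close>

text \<open>The induction step is \<open>1 / sqrt (i + 1) \<le> 2 * (sqrt (i + 1) - sqrt i)\<close>,
  the discrete form of integrating an inverse square root; it reduces to the inequality between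
  geometric and arithmetic mean.\<close>

lemma sum_inverse_sqrt_le: "(\<Sum>k\<le>m. 1 / sqrt (real (k - j))) \<le> 2 * sqrt (real (m - j))"
proof (induction m)
  case (Suc m)
  show ?case
  proof (cases "Suc m \<le> j")
    case True
    then show ?thesis using Suc by simp
  next
    case False
    define i where "i = m - j"
    have i: "Suc m - j = Suc i" using False by (simp add: i_def)
    have "(2 * sqrt (real i)) * (2 * sqrt (real (Suc i))) \<le> (2 * real (Suc i) - 1) * 2"
    proof -
      have "(2 * sqrt (real i)) * (2 * sqrt (real (Suc i))) \<le> 2 * ((sqrt (real i))\<^sup>2 + (sqrt (real (Suc i)))\<^sup>2)"
        using sum_squares_bound[of "sqrt (real i)" "sqrt (real (Suc i))"] by simp
      then show ?thesis by simp
    qed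
    then have "2 * sqrt (real i) + 1 / sqrt (real (Suc i)) \<le> 2 * sqrt (real (Suc i))"
      by (simp add: field_simps)
    then show ?thesis using Suc unfolding i sum.atMost_Suc i_def[symmetric] by linarith
  qed
qed simp

lemma double_sum_inverse_sqrt_le:
  "(\<Sum>j\<in>{n..<2*n}. \<Sum>k\<in>{n..<2*n}. 1 / sqrt (real (j - k)) + 1 / sqrt (real (k - j))) \<le> 4 * real n * sqrt (real n)"
proof -
  \<comment> \<open>Truncated subtraction and 1 / sqrt 0 = 0 make all terms with k at most j vanish.\<close>
  let ?I = "{n..<2*n}"
  have "(\<Sum>j\<in>?I. \<Sum>k\<in>?I. 1 / sqrt (real (k - j))) \<le> (\<Sum>j\<in>?I. 2 * sqrt (real n))"
  proof (rule sum_mono)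
    fix j assume j: "j \<in> ?I"
    have "(\<Sum>k\<in>?I. 1 / sqrt (real (k - j))) \<le> (\<Sum>k\<le>2*n. 1 / sqrt (real (k - j)))"
      by (intro sum_mono2) auto
    also have "\<dots> \<le> 2 * sqrt (real (2 * n - j))" by (rule sum_inverse_sqrt_le)
    also have "\<dots> \<le> 2 * sqrt (real n)" using j by (intro mult_left_mono real_sqrt_le_mono) auto
    finally show "(\<Sum>k\<in>?I. 1 / sqrt (real (k - j))) \<le> 2 * sqrt (real n)" .
  qed
  then have 1: "(\<Sum>j\<in>?I. \<Sum>k\<in>?I. 1 / sqrt (real (k - j))) \<le> 2 * real n * sqrt (real n)" by simp
  have "(\<Sum>j\<in>?I. \<Sum>k\<in>?I. 1 / sqrt (real (j - k))) = (\<Sum>j\<in>?I. \<Sum>k\<in>?I. 1 / sqrt (real (k - j)))"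
    by (rule sum.swap)
  with 1 show ?thesis by (simp add: sum.distrib)
qed

context filtered_brownian begin

text \<open>The times \<open>t k\<close> with \<open>k\<close> from \<open>n\<close> to
  \<open>2 * n - 1\<close> lie between \<open>T / 2\<close> and \<open>T\<close>, away from the
  singularity of the kernel at time 0. The unit \<open>y\<close> is \<open>n\<close> times the
  integral times the largest density at time \<open>T / 2\<close>; the lower kernel bound loses only
  the factor \<open>exp (-1) / sqrt 2\<close> against it.\<close>

lemma occupation_first_moment_ge:
  assumes D: "D \<in> sets (F 0)" and T: "T > 0" and n: "n > 0"
    and \<phi>: "integrable lborel \<phi>" "\<And>x. 0 \<le> \<phi> x" "\<And>x. \<phi> x \<le> B" and supp: "\<And>z. z\<^sup>2 > T \<Longrightarrow> \<phi> z = 0"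
  defines "t \<equiv> \<lambda>k. real k * (T / (2 * real n))"
  defines "y \<equiv> real n * (\<integral>x. \<phi> x \<partial>lborel) / sqrt (pi * T)"
  shows "(\<integral>\<omega>. indicator D \<omega> * (\<Sum>k\<in>{n..<2*n}. \<phi> (W (t k) \<omega>)) \<partial>M) \<ge> measure M D * (exp (-1) / sqrt 2 * y)"
proof -
  let ?I = "{n..<2*n}"
  have [measurable]: "\<phi> \<in> borel_measurable borel" using \<phi>(1) by auto
  have t: "T / 2 \<le> t k" "t k \<le> T" if "k \<in> ?I" for k
    using that n T by (auto simp: t_def field_simps)
  have "B \<ge> 0" using \<phi>(2,3)[of 0] by linarith
  have [measurable]: "D \<in> sets M" "W (t k) \<in> borel_measurable M" for k
    using T by (auto intro: W_measurable sets_F[OF _ D] simp: t_def)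
  have int: "integrable M (\<lambda>\<omega>. indicator D \<omega> * \<phi> (W (t k) \<omega>))" for k
    using \<phi> \<open>B \<ge> 0\<close> by (intro integrable_const_bound[of _ B]) (auto simp: indicator_def)
  have "measure M D * (exp (-1) / sqrt 2 * y) =
      (\<Sum>k\<in>?I. measure M D * (exp (-1) / sqrt (2 * pi * T) * (\<integral>x. \<phi> x \<partial>lborel)))"
    using T n by (simp add: y_def real_sqrt_mult ac_simps)
  also have "\<dots> \<le> (\<Sum>k\<in>?I. measure M D * heat (t k) \<phi> 0)"
    by (intro sum_mono mult_left_mono heat_ge_integral[OF T t, where C = B] \<phi> supp)
      (use \<phi>(2,3) in auto)
  also have "\<dots> = (\<Sum>k\<in>?I. \<integral>\<omega>. indicator D \<omega> * \<phi> (W (t k) \<omega>) \<partial>M)"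
    by (intro sum.cong refl expectation_from_start[symmetric, where C = B] D)
      (use \<phi>(2,3) t T in \<open>auto simp: t_def\<close>)
  also have "\<dots> = (\<integral>\<omega>. indicator D \<omega> * (\<Sum>k\<in>?I. \<phi> (W (t k) \<omega>)) \<partial>M)"
    unfolding sum_distrib_left using int by (intro Bochner_Integration.integral_sum[symmetric])
  finally show ?thesis .
qed

text \<open>Off the diagonal the Markov property at \<open>s\<close> splits the pair into two
  kernels, each bounded by its maximum, so that only the integral of \<open>\<phi>\<close> and the
  time gap enter. On the diagonal there is no gap to smooth over, and one factor is estimated by
  \<open>B\<close>.\<close>

lemma occupation_pair_moment_le:
  assumes D: "D \<in> sets (F 0)" and su: "0 < a" "a \<le> s" "s < u"
    and \<phi>: "integrable lborel \<phi>" "\<And>x. 0 \<le> \<phi> x" "\<And>x. \<phi> x \<le> B"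
  shows "(\<integral>\<omega>. indicator D \<omega> * (\<phi> (W s \<omega>) * \<phi> (W u \<omega>)) \<partial>M) \<le>
    measure M D * ((\<integral>x. \<phi> x \<partial>lborel) / sqrt (2 * pi * a)) * ((\<integral>x. \<phi> x \<partial>lborel) / sqrt (2 * pi * (u - s)))"
    and "(\<integral>\<omega>. indicator D \<omega> * (\<phi> (W s \<omega>) * \<phi> (W s \<omega>)) \<partial>M) \<le>
    measure M D * ((\<integral>x. \<phi> x \<partial>lborel) / sqrt (2 * pi * a)) * B"
proof -
  let ?J = "\<integral>x. \<phi> x \<partial>lborel"
  have [measurable]: "\<phi> \<in> borel_measurable borel" using \<phi>(1) by auto
  have "B \<ge> 0" using \<phi>(2,3)[of 0] by linarith
  have "?J \<ge> 0" using \<phi>(2) by simp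
  have abs: "\<bar>\<phi> x\<bar> \<le> B" for x using \<phi>(2,3)[of x] by simp
  have [measurable]: "D \<in> sets M" "W s \<in> borel_measurable M" "W u \<in> borel_measurable M"
    using su by (auto intro: W_measurable sets_F[OF _ D])
  have [measurable]: "D \<in> sets (F s)" "W s \<in> borel_measurable (F s)"
    using su by (auto intro: sets_F_mono[OF _ _ D] W_adapted)
  have int: "integrable M (\<lambda>\<omega>. indicator D \<omega> * \<phi> (W s \<omega>))"
    using \<phi> \<open>B \<ge> 0\<close> by (intro integrable_const_bound[of _ B]) (auto simp: indicator_def)
  have first: "(\<integral>\<omega>. indicator D \<omega> * \<phi> (W s \<omega>) \<partial>M) \<le> measure M D * (?J / sqrt (2 * pi * a))"
  proof -
    have "(\<integral>\<omega>. indicator D \<omega> * \<phi> (W s \<omega>) \<partial>M) = measure M D * heat s \<phi> 0"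
      using su abs by (intro expectation_from_start D) auto
    also have "\<dots> \<le> measure M D * (?J / sqrt (2 * pi * s))"
      using su by (intro mult_left_mono heat_le_integral \<phi>) auto
    also have "\<dots> \<le> measure M D * (?J / sqrt (2 * pi * a))"
      using su \<open>?J \<ge> 0\<close> by (intro mult_left_mono divide_left_mono) auto
    finally show ?thesis .
  qed
  have "(\<integral>\<omega>. indicator D \<omega> * (\<phi> (W s \<omega>) * \<phi> (W s \<omega>)) \<partial>M) \<le> (\<integral>\<omega>. (indicator D \<omega> * \<phi> (W s \<omega>)) * B \<partial>M)"
  proof (rule integral_mono)
    have "\<bar>\<phi> x * \<phi> x\<bar> \<le> B * B" for x
      using abs unfolding abs_mult by (intro mult_mono) (auto simp: \<open>B \<ge> 0\<close>)
    then show "integrable M (\<lambda>\<omega>. indicator D \<omega> * (\<phi> (W s \<omega>) * \<phi> (W s \<omega>)))"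
      using \<open>B \<ge> 0\<close> by (intro integrable_const_bound[of _ "B * B"]) (auto simp: indicator_def)
    show "integrable M (\<lambda>\<omega>. (indicator D \<omega> * \<phi> (W s \<omega>)) * B)" using int by simp
    show "indicator D \<omega> * (\<phi> (W s \<omega>) * \<phi> (W s \<omega>)) \<le> (indicator D \<omega> * \<phi> (W s \<omega>)) * B" for \<omega>
      using \<phi>(2,3) by (auto simp: indicator_def intro: mult_left_mono)
  qed
  also have "\<dots> \<le> measure M D * (?J / sqrt (2 * pi * a)) * B"
    using mult_right_mono[OF first \<open>B \<ge> 0\<close>] by simp
  finally show "(\<integral>\<omega>. indicator D \<omega> * (\<phi> (W s \<omega>) * \<phi> (W s \<omega>)) \<partial>M) \<le> measure M D * (?J / sqrt (2 * pi * a)) * B" .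
  let ?c = "?J / sqrt (2 * pi * (u - s))"
  have "?c \<ge> 0" using \<open>?J \<ge> 0\<close> su by simp
  have "(\<integral>\<omega>. indicator D \<omega> * (\<phi> (W s \<omega>) * \<phi> (W u \<omega>)) \<partial>M) = (\<integral>\<omega>. (indicator D \<omega> * \<phi> (W s \<omega>)) * \<phi> (W u \<omega>) \<partial>M)"
    by (simp add: mult.assoc)
  also have "\<dots> = (\<integral>\<omega>. (indicator D \<omega> * \<phi> (W s \<omega>)) * heat (u - s) \<phi> (W s \<omega>) \<partial>M)"
    using su abs \<open>B \<ge> 0\<close> by (intro markov_property[where B = B]) (auto simp: indicator_def)
  also have "\<dots> \<le> (\<integral>\<omega>. (indicator D \<omega> * \<phi> (W s \<omega>)) * ?c \<partial>M)"
  proof (rule integral_mono)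
    have "\<bar>\<phi> x * heat (u - s) \<phi> x\<bar> \<le> B * B" for x
      using abs abs_heat_le[of "u - s" \<phi> B x] su unfolding abs_mult by (intro mult_mono) (auto simp: \<open>B \<ge> 0\<close>)
    then show "integrable M (\<lambda>\<omega>. (indicator D \<omega> * \<phi> (W s \<omega>)) * heat (u - s) \<phi> (W s \<omega>))"
      using \<open>B \<ge> 0\<close> by (intro integrable_const_bound[of _ "B * B"]) (auto simp: indicator_def)
    show "integrable M (\<lambda>\<omega>. (indicator D \<omega> * \<phi> (W s \<omega>)) * ?c)" using int by (rule integrable_mult_left)
    show "(indicator D \<omega> * \<phi> (W s \<omega>)) * heat (u - s) \<phi> (W s \<omega>) \<le> (indicator D \<omega> * \<phi> (W s \<omega>)) * ?c" for \<omega>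
      using su \<phi>(2) by (intro mult_left_mono heat_le_integral \<phi>) auto
  qed
  also have "\<dots> = (\<integral>\<omega>. indicator D \<omega> * \<phi> (W s \<omega>) \<partial>M) * ?c" by (rule integral_mult_left_zero)
  also have "\<dots> \<le> measure M D * (?J / sqrt (2 * pi * a)) * ?c"
    by (intro mult_right_mono first \<open>?c \<ge> 0\<close>)
  finally show "(\<integral>\<omega>. indicator D \<omega> * (\<phi> (W s \<omega>) * \<phi> (W u \<omega>)) \<partial>M) \<le> measure M D * (?J / sqrt (2 * pi * a)) * ?c" .
qed

text \<open>The inverse square roots of the gaps sum to order \<open>n * sqrt n\<close>, and a gap
  of one grid step has a kernel of order \<open>sqrt n\<close>. The off-diagonal part is therefore
  of order \<open>y\<^sup>2\<close>, comparable with the square of the first moment, while the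
  diagonal adds \<open>y * B\<close>. The constants depend neither on \<open>n\<close> nor on
  \<open>\<phi>\<close>.\<close>

lemma occupation_second_moment_le:
  assumes D: "D \<in> sets (F 0)" and T: "T > 0" and n: "n > 0"
    and \<phi>: "integrable lborel \<phi>" "\<And>x. 0 \<le> \<phi> x" "\<And>x. \<phi> x \<le> B"
  defines "t \<equiv> \<lambda>k. real k * (T / (2 * real n))"
  defines "y \<equiv> real n * (\<integral>x. \<phi> x \<partial>lborel) / sqrt (pi * T)"
  shows "integrable M (\<lambda>\<omega>. indicator D \<omega> * (\<Sum>k\<in>{n..<2*n}. \<phi> (W (t k) \<omega>))\<^sup>2)"
    "(\<integral>\<omega>. indicator D \<omega> * (\<Sum>k\<in>{n..<2*n}. \<phi> (W (t k) \<omega>))\<^sup>2 \<partial>M) \<le> measure M D * (y * (B + 4 * y))"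
proof -
  let ?I = "{n..<2*n}"
  let ?J = "\<integral>x. \<phi> x \<partial>lborel"
  have [measurable]: "\<phi> \<in> borel_measurable borel" using \<phi>(1) by auto
  have "B \<ge> 0" using \<phi>(2,3)[of 0] by linarith
  have "?J \<ge> 0" using \<phi>(2) by simp
  have abs: "\<bar>\<phi> x\<bar> \<le> B" for x using \<phi>(2,3)[of x] by simp
  have [measurable]: "D \<in> sets M" "W (t k) \<in> borel_measurable M" for k
    using T by (auto intro: W_measurable sets_F[OF _ D] simp: t_def)
  have t: "T / 2 \<le> t k" if "k \<in> ?I" for k
    using that n T by (auto simp: t_def field_simps)
  have tdiff: "t k - t j = real (k - j) * (T / (2 * real n))" if "j < k" for j k
    using that by (simp only: t_def left_diff_distrib of_nat_diff less_imp_le)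
  have tless: "t j < t k" if "j < k" for j k
    unfolding t_def using that T n by (intro mult_strict_right_mono) auto
  let ?p = "\<lambda>j k. \<integral>\<omega>. indicator D \<omega> * (\<phi> (W (t j) \<omega>) * \<phi> (W (t k) \<omega>)) \<partial>M"
  \<comment> \<open>\<open>?q\<close> contains the kernel bound for the earlier time, which is at
    least \<open>T / 2\<close>, and \<open>?e\<close> is the kernel bound for a gap of a single grid
    step.\<close>
  let ?q = "measure M D * (?J / sqrt (pi * T))"
  let ?e = "?J / sqrt (2 * pi * (T / (2 * real n)))"
  have "?q \<ge> 0" "?e \<ge> 0" using \<open>?J \<ge> 0\<close> T n by auto
  have lt: "?p j k \<le> ?q * (?e * (1 / sqrt (real (k - j))))" if "j \<in> ?I" "j < k" for j k
  proof -
    have "?p j k \<le> measure M D * (?J / sqrt (2 * pi * (T / 2))) * (?J / sqrt (2 * pi * (t k - t j)))"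
      by (rule occupation_pair_moment_le(1)[OF D _ t[OF that(1)] tless[OF that(2)] \<phi>]) (use T in simp)
    also have "\<dots> = ?q * (?e * (1 / sqrt (real (k - j))))"
      unfolding tdiff[OF that(2)] by (simp add: real_sqrt_mult real_sqrt_divide)
    finally show ?thesis .
  qed
  have eq: "?p j j \<le> ?q * B" if "j \<in> ?I" for j
    using occupation_pair_moment_le(2)[OF D _ t[OF that] less_add_one \<phi>] T by simp
  have pair: "?p j k \<le> ?q * ((if j = k then B else 0) + ?e * (1 / sqrt (real (j - k)) + 1 / sqrt (real (k - j))))"
    if "j \<in> ?I" "k \<in> ?I" for j k
  proof (rule linorder_cases[of j k])
    assume "j = k"
    then show ?thesis using eq[OF that(1)] by simp
  next
    assume "j < k"
    then show ?thesis using lt[OF that(1)] by simp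
  next
    assume "k < j"
    then show ?thesis using lt[OF that(2)] by (simp add: mult.commute[of "\<phi> (W (t j) _)"])
  qed
  have bb: "\<bar>\<phi> x * \<phi> z\<bar> \<le> B * B" for x z
    using abs unfolding abs_mult by (intro mult_mono) (auto simp: \<open>B \<ge> 0\<close>)
  then have int: "integrable M (\<lambda>\<omega>. indicator D \<omega> * (\<phi> (W (t j) \<omega>) * \<phi> (W (t k) \<omega>)))" for j k
    using \<open>B \<ge> 0\<close> by (intro integrable_const_bound[of _ "B * B"]) (auto simp: indicator_def)
  have sq: "indicator D \<omega> * (\<Sum>k\<in>?I. \<phi> (W (t k) \<omega>))\<^sup>2 =
      (\<Sum>j\<in>?I. \<Sum>k\<in>?I. indicator D \<omega> * (\<phi> (W (t j) \<omega>) * \<phi> (W (t k) \<omega>)))" for \<omega>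
    unfolding power2_eq_square sum_product by (simp only: sum_distrib_left)
  show "integrable M (\<lambda>\<omega>. indicator D \<omega> * (\<Sum>k\<in>?I. \<phi> (W (t k) \<omega>))\<^sup>2)"
    unfolding sq by (intro Bochner_Integration.integrable_sum int)
  have "(\<integral>\<omega>. indicator D \<omega> * (\<Sum>k\<in>?I. \<phi> (W (t k) \<omega>))\<^sup>2 \<partial>M) = (\<Sum>j\<in>?I. \<integral>\<omega>. (\<Sum>k\<in>?I. indicator D \<omega> * (\<phi> (W (t j) \<omega>) * \<phi> (W (t k) \<omega>))) \<partial>M)"
    unfolding sq by (intro Bochner_Integration.integral_sum Bochner_Integration.integrable_sum int)
  also have "\<dots> = (\<Sum>j\<in>?I. \<Sum>k\<in>?I. ?p j k)"
    by (intro sum.cong refl Bochner_Integration.integral_sum int)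
  also have "\<dots> \<le> (\<Sum>j\<in>?I. \<Sum>k\<in>?I. ?q * ((if j = k then B else 0) + ?e * (1 / sqrt (real (j - k)) + 1 / sqrt (real (k - j)))))"
    by (intro sum_mono pair)
  also have "\<dots> = ?q * ((\<Sum>j\<in>?I. \<Sum>k\<in>?I. if j = k then B else 0) +
       ?e * (\<Sum>j\<in>?I. \<Sum>k\<in>?I. 1 / sqrt (real (j - k)) + 1 / sqrt (real (k - j))))"
    by (simp only: sum_distrib_left sum.distrib distrib_left)
  also have "(\<Sum>j\<in>?I. \<Sum>k\<in>?I. if j = k then B else 0) = real n * B" by simp
  also have "?q * (real n * B + ?e * (\<Sum>j\<in>?I. \<Sum>k\<in>?I. 1 / sqrt (real (j - k)) + 1 / sqrt (real (k - j)))) \<le>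
      ?q * (real n * B + ?e * (4 * real n * sqrt (real n)))"
    by (intro mult_left_mono add_left_mono double_sum_inverse_sqrt_le \<open>?q \<ge> 0\<close> \<open>?e \<ge> 0\<close>)
  also have "?e = ?J * sqrt (real n) / sqrt (pi * T)"
    using T n by (simp add: real_sqrt_mult real_sqrt_divide)
  also have "?J * sqrt (real n) / sqrt (pi * T) * (4 * real n * sqrt (real n)) = real n * (4 * y)"
    using n by (simp add: y_def)
  also have "?q * (real n * B + real n * (4 * y)) = measure M D * (y * (B + 4 * y))"
    by (simp add: y_def distrib_left ac_simps)
  finally show "(\<integral>\<omega>. indicator D \<omega> * (\<Sum>k\<in>?I. \<phi> (W (t k) \<omega>))\<^sup>2 \<partial>M) \<le> measure M D * (y * (B + 4 * y))" .
qed

end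

section \<open>The main estimate\<close>

lemma (in prob_space) measure_tendsto_0_of_AE_eventually_not_in:
  assumes [measurable]: "\<And>n. S n \<in> sets M" and "AE \<omega> in M. \<forall>\<^sub>F n in sequentially. \<omega> \<notin> S n"
  shows "(\<lambda>n. measure M (S n)) \<longlonglongrightarrow> 0"
proof -
  have "(\<lambda>n. \<integral>\<omega>. indicator (S n) \<omega> \<partial>M) \<longlonglongrightarrow> (\<integral>\<omega>. (0 :: real) \<partial>M)"
  proof (rule integral_dominated_convergence)
    show "AE \<omega> in M. (\<lambda>n. indicator (S n) \<omega> :: real) \<longlonglongrightarrow> 0"
      using assms(2)
    proof eventually_elim
      case (elim \<omega>)
      then have "\<forall>\<^sub>F n in sequentially. indicator (S n) \<omega> = (0 :: real)" by (auto elim!: eventually_mono)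
      then show ?case by (rule tendsto_eventually)
    qed
    show "integrable M (\<lambda>\<omega>. 1 :: real)" by simp
  qed (auto simp: indicator_def)
  then show ?thesis by simp
qed

context filtered_brownian begin

text \<open>In the spirit of Paley and Zygmund, the second moment limits the share of the occupation
  sum carried by \<open>S\<close> to half of the lower bound for the first moment, up to a multiple
  of \<open>B\<close>. What is observed off \<open>S\<close> then controls \<open>y\<close>, and
  with it the integral of \<open>\<phi>\<close>.\<close>

lemma occupation_bound_off_small_set:
  assumes D: "D \<in> sets (F 0)" "measure M D > 0" and T: "T > 0" and n: "n > 0"
    and \<phi>: "integrable lborel \<phi>" "\<And>x. 0 \<le> \<phi> x" "\<And>x. \<phi> x \<le> B" and "B > 0"
    and supp: "\<And>z. z\<^sup>2 > T \<Longrightarrow> \<phi> z = 0"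
    and S [measurable]: "S \<in> sets M" and small: "measure M (D \<inter> S) \<le> (exp (-1) / sqrt 2)\<^sup>2 / 16 * measure M D"
  defines "t \<equiv> \<lambda>k. real k * (T / (2 * real n))"
  assumes C1: "(\<integral>\<omega>. indicator (D - S) \<omega> * (\<Sum>k\<in>{n..<2*n}. \<phi> (W (t k) \<omega>)) \<partial>M) \<le> C1"
  shows "(\<integral>x. \<phi> x \<partial>lborel) \<le>
    2 / T * sqrt (pi * T) * (2 / (exp (-1) / sqrt 2) * (C1 / measure M D) + B / 8) * (T / (2 * real n))"
proof -
  let ?Z = "\<lambda>\<omega>. \<Sum>k\<in>{n..<2*n}. \<phi> (W (t k) \<omega>)" and ?J = "\<integral>x. \<phi> x \<partial>lborel"
  define y where "y = real n * ?J / sqrt (pi * T)"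
  define c where "c = exp (-1) / sqrt (2::real)"
  have "c > 0" by (simp add: c_def)
  have "y \<ge> 0" using \<phi>(2) T by (simp add: y_def)
  have By: "B + 4 * y > 0" using \<open>B > 0\<close> \<open>y \<ge> 0\<close> by simp
  have [measurable]: "\<phi> \<in> borel_measurable borel" "D \<in> sets M" "W (t k) \<in> borel_measurable M" for k
    using T \<phi>(1) by (auto intro: W_measurable sets_F[OF _ D(1)] simp: t_def)
  have first: "measure M D * (c * y) \<le> (\<integral>\<omega>. indicator D \<omega> * ?Z \<omega> \<partial>M)"
    unfolding t_def y_def c_def by (rule occupation_first_moment_ge[OF D(1) T n \<phi> supp])
  have second: "integrable M (\<lambda>\<omega>. indicator D \<omega> * (?Z \<omega>)\<^sup>2)"
    "(\<integral>\<omega>. indicator D \<omega> * (?Z \<omega>)\<^sup>2 \<partial>M) \<le> measure M D * (y * (B + 4 * y))"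
    unfolding t_def y_def by (rule occupation_second_moment_le[OF D(1) T n \<phi>])+
  have Z_bd: "\<bar>?Z \<omega>\<bar> \<le> real n * B" for \<omega>
    using sum_bounded_above[of "{n..<2*n}" "\<lambda>k. \<phi> (W (t k) \<omega>)" B] \<phi>(2,3) by (simp add: sum_nonneg)
  have intA: "integrable M (\<lambda>\<omega>. indicator A \<omega> * ?Z \<omega>)" if [measurable]: "A \<in> sets M" for A
    using Z_bd \<open>B > 0\<close> by (intro integrable_const_bound[of _ "real n * B"]) (auto simp: indicator_def)
  \<comment> \<open>Young's inequality replaces Cauchy-Schwarz; this weight balances both terms.\<close>
  define \<theta> where "\<theta> = c / (2 * (B + 4 * y))"
  have "\<theta> > 0" using \<open>c > 0\<close> By by (simp add: \<theta>_def)
  have young: "z \<le> 1 / (2 * \<theta>) + \<theta> / 2 * z\<^sup>2" for z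
  proof -
    have "0 \<le> (\<theta> * z - 1)\<^sup>2 / (2 * \<theta>)" using \<open>\<theta> > 0\<close> by simp
    also have "\<dots> = 1 / (2 * \<theta>) + \<theta> / 2 * z\<^sup>2 - z"
      using \<open>\<theta> > 0\<close> by (simp add: power2_eq_square field_simps)
    finally show ?thesis by simp
  qed
  have int_ind: "integrable M (\<lambda>\<omega>. 1 / (2 * \<theta>) * indicator (D \<inter> S) \<omega> :: real)"
    by (intro integrable_mult_right integrable_const_bound[of _ 1]) auto
  have int_sq: "integrable M (\<lambda>\<omega>. \<theta> / 2 * (indicator D \<omega> * (?Z \<omega>)\<^sup>2))"
    by (intro integrable_mult_right second(1))
  have "(\<integral>\<omega>. indicator (D \<inter> S) \<omega> * ?Z \<omega> \<partial>M) \<le>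
      (\<integral>\<omega>. 1 / (2 * \<theta>) * indicator (D \<inter> S) \<omega> + \<theta> / 2 * (indicator D \<omega> * (?Z \<omega>)\<^sup>2) \<partial>M)"
  proof (rule integral_mono)
    show "integrable M (\<lambda>\<omega>. indicator (D \<inter> S) \<omega> * ?Z \<omega>)" by (rule intA) simp
    show "integrable M (\<lambda>\<omega>. 1 / (2 * \<theta>) * indicator (D \<inter> S) \<omega> + \<theta> / 2 * (indicator D \<omega> * (?Z \<omega>)\<^sup>2))"
      by (intro Bochner_Integration.integrable_add int_ind int_sq)
    show "indicator (D \<inter> S) \<omega> * ?Z \<omega> \<le> 1 / (2 * \<theta>) * indicator (D \<inter> S) \<omega> + \<theta> / 2 * (indicator D \<omega> * (?Z \<omega>)\<^sup>2)" for \<omega>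
      using young[of "?Z \<omega>"] \<open>\<theta> > 0\<close> by (auto simp: indicator_def)
  qed
  also have "\<dots> = 1 / (2 * \<theta>) * measure M (D \<inter> S) + \<theta> / 2 * (\<integral>\<omega>. indicator D \<omega> * (?Z \<omega>)\<^sup>2 \<partial>M)"
    by (subst Bochner_Integration.integral_add[OF int_ind int_sq]) simp
  also have "\<dots> \<le> 1 / (2 * \<theta>) * (c\<^sup>2 / 16 * measure M D) + \<theta> / 2 * (measure M D * (y * (B + 4 * y)))"
    using small second(2) \<open>\<theta> > 0\<close> by (intro add_mono mult_left_mono) (auto simp: c_def)
  \<comment> \<open>Up to the factor \<open>measure M D\<close>, the two terms are
    \<open>c * B / 16 + c * y / 4\<close> and \<open>c * y / 4\<close>. The 1/16 in the smallness
    hypothesis is chosen so that only half of \<open>c * y\<close> is lost.\<close>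
  also have "\<dots> = measure M D * (c * B / 16 + c * y / 2)"
  proof -
    have 1: "1 / (2 * \<theta>) = (B + 4 * y) / c" and 2: "\<theta> * (B + 4 * y) = c / 2"
      using By \<open>c > 0\<close> by (simp_all add: \<theta>_def field_simps)
    have 3: "\<theta> / 2 * (measure M D * (y * (B + 4 * y))) = measure M D * y / 2 * (c / 2)"
      unfolding 2[symmetric] by simp
    show ?thesis
      unfolding 1 3 using \<open>c > 0\<close> by (simp add: field_simps power2_eq_square)
  qed
  finally have bad: "(\<integral>\<omega>. indicator (D \<inter> S) \<omega> * ?Z \<omega> \<partial>M) \<le> measure M D * (c * B / 16 + c * y / 2)" .
  have "(\<integral>\<omega>. indicator D \<omega> * ?Z \<omega> \<partial>M) = (\<integral>\<omega>. indicator (D - S) \<omega> * ?Z \<omega> + indicator (D \<inter> S) \<omega> * ?Z \<omega> \<partial>M)"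
    by (intro Bochner_Integration.integral_cong refl) (auto simp: indicator_def)
  also have "\<dots> = (\<integral>\<omega>. indicator (D - S) \<omega> * ?Z \<omega> \<partial>M) + (\<integral>\<omega>. indicator (D \<inter> S) \<omega> * ?Z \<omega> \<partial>M)"
    by (intro Bochner_Integration.integral_add intA) auto
  finally have "measure M D * (c * y) \<le> C1 + measure M D * (c * B / 16 + c * y / 2)"
    using first bad C1 by linarith
  then have "measure M D * (c * y / 2) \<le> C1 + measure M D * (c * B / 16)"
    by (simp add: algebra_simps)
  then have "y \<le> 2 / c * (C1 / measure M D) + B / 8"
    using \<open>c > 0\<close> D(2) by (simp add: field_simps)
  \<comment> \<open>The factors undo the normalisation in \<open>y\<close>;
    \<open>T / (2 * real n)\<close> is kept apart as the time step, in which the estimate is to be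
    linear.\<close>
  then have "2 / T * sqrt (pi * T) * y * (T / (2 * real n)) \<le>
      2 / T * sqrt (pi * T) * (2 / c * (C1 / measure M D) + B / 8) * (T / (2 * real n))"
    using T by (intro mult_right_mono mult_left_mono) auto
  moreover have "2 / T * sqrt (pi * T) * y * (T / (2 * real n)) = ?J"
    using T n by (simp add: y_def)
  ultimately show ?thesis by (simp add: c_def)
qed

text \<open>The order of the choices matters: \<open>T\<close> depends on \<open>\<tau>\<close> and
  \<open>W\<close>, the indices \<open>m\<close> and \<open>K\<close> depend on \<open>T\<close>,
  and all are fixed before the grid size \<open>n\<close>. Hence one bad set \<open>S\<close>, one
  constant \<open>C2\<close> and one radius \<open>r\<close> serve all step sizes.\<close>

lemma heat_estimate_of_semimartingale:
  assumes \<tau>: "stopping_time_on M F \<tau>" "measure M {\<omega>\<in>space M. 0 < \<tau> \<omega>} > 0"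
    and semi: "semimartingale M F (\<lambda>t \<omega>. f (stopped W \<tau> t \<omega>))"
    and g: "continuous_on UNIV g" "\<And>x. \<bar>g x\<bar> \<le> C" and "C > 0"
    and "b > 0" and fg: "\<And>x. \<bar>x\<bar> \<le> b \<Longrightarrow> f x = g x"
  shows "\<exists>r>0. r \<le> b \<and> (\<exists>K h. (\<forall>i. h i > 0) \<and> h \<longlonglongrightarrow> 0 \<and>
     (\<forall>i::nat. integral {-r..r} (\<lambda>x. \<bar>heat (h i) g x - g x\<bar>) \<le> K * h i))"
proof -
  define D where "D = {\<omega>\<in>space M. 0 < \<tau> \<omega>}"
  have D0: "D \<in> sets (F 0)" using stopping_time_measurable(2)[OF \<tau>(1), of 0] by (simp add: D_def)
  have Dpos: "measure M D > 0" using \<tau>(2) by (simp add: D_def)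
  have [measurable]: "D \<in> sets M" by (rule sets_F[OF _ D0]) simp
  have [measurable]: "g \<in> borel_measurable borel" using g(1) by (rule borel_measurable_continuous_onI)
  obtain L A where L: "local_martingale M F L" and A: "finite_variation_process M F A"
    and LA0: "\<And>\<omega>. \<omega> \<in> space M \<Longrightarrow> A 0 \<omega> = 0"
    and decomp: "AE \<omega> in M. \<forall>t\<ge>0. f (stopped W \<tau> t \<omega>) = f (stopped W \<tau> 0 \<omega>) + L t \<omega> + A t \<omega>"
    using semi by (auto simp: semimartingale_def)
  obtain \<sigma> where \<sigma>: "\<And>n. stopping_time_on M F (\<sigma> n)" "AE \<omega> in M. (\<lambda>n. \<sigma> n \<omega>) \<longlonglongrightarrow> \<infinity>"
    "\<And>n. martingale M F (stopped L (\<sigma> n))"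
    using L by (auto simp: local_martingale_def)
  have A_adapted: "A t \<in> borel_measurable (F t)" if "t \<ge> 0" for t
    using A that by (simp add: finite_variation_process_def adapted_def)
  have W_m: "W t \<in> borel_measurable M" if "t \<ge> 0" for t by (rule W_measurable[OF that])
  have A_m: "A t \<in> borel_measurable M" if "t \<ge> 0" for t by (rule measurable_F[OF that A_adapted[OF that]])
  \<comment> \<open>Four bad sets share the threshold with denominator 16, hence the 64.\<close>
  define \<eta> where "\<eta> = (exp (-1) / sqrt 2)\<^sup>2 / 64 * measure M D"
  have "\<eta> > 0" using Dpos by (simp add: \<eta>_def)

  \<comment> \<open>Choice of the time horizon \<open>T\<close>\<close>
  define Ti where "Ti i = 1 / real (Suc i)" for i
  have Ti: "Ti i > 0" "Ti i \<in> \<rat>" for i by (auto simp: Ti_def)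
  have Ti0: "Ti \<longlonglongrightarrow> 0" unfolding Ti_def using LIMSEQ_inverse_real_of_nat by (simp add: inverse_eq_divide)
  define S1 where "S1 i = D \<inter> {\<omega>\<in>space M. \<tau> \<omega> \<le> ennreal (Ti i)}" for i
  \<comment> \<open>Rational times make this a countable union. The horizons are rational as well,
    so every grid time up to \<open>T\<close> is covered, whatever \<open>n\<close> is.\<close>
  define S2 where "S2 i = (\<Union>q\<in>\<rat> \<inter> {0..Ti i}. {\<omega>\<in>space M. b < \<bar>W q \<omega>\<bar>})" for i
  have S1m [measurable]: "S1 i \<in> sets M" for i
    unfolding S1_def using Ti[of i] sets_F[OF _ stopping_time_measurable(1)[OF \<tau>(1)], of "Ti i"] by (auto intro!: sets.Int)
  have S2m [measurable]: "S2 i \<in> sets M" for i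
    unfolding S2_def
  proof (rule sets.countable_UN'')
    show "countable (\<rat> \<inter> {0..Ti i})" using countable_rat by blast
    show "{\<omega>\<in>space M. b < \<bar>W q \<omega>\<bar>} \<in> sets M" if "q \<in> \<rat> \<inter> {0..Ti i}" for q
    proof -
      have [measurable]: "W q \<in> borel_measurable M" using that by (intro W_m) auto
      show ?thesis by measurable
    qed
  qed
  have "(\<lambda>i. measure M (S1 i)) \<longlonglongrightarrow> 0"
  proof (rule measure_tendsto_0_of_AE_eventually_not_in[OF S1m], rule AE_I2)
    fix \<omega>
    show "\<forall>\<^sub>F i in sequentially. \<omega> \<notin> S1 i"
    proof (cases "\<omega> \<in> D")
      case True
      have "(\<lambda>i. ennreal (Ti i)) \<longlonglongrightarrow> ennreal 0" by (intro tendsto_ennrealI Ti0)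
      then have "\<forall>\<^sub>F i in sequentially. ennreal (Ti i) < \<tau> \<omega>"
        using True by (intro order_tendstoD) (auto simp: D_def)
      then show ?thesis by eventually_elim (auto simp: S1_def)
    qed (simp add: S1_def)
  qed
  then have E1: "\<forall>\<^sub>F i in sequentially. measure M (S1 i) < \<eta>" using \<open>\<eta> > 0\<close> by (rule order_tendstoD)
  have "(\<lambda>i. measure M (S2 i)) \<longlonglongrightarrow> 0"
  proof (rule measure_tendsto_0_of_AE_eventually_not_in[OF S2m])
    have "AE \<omega> in M. W 0 \<omega> = 0" "AE \<omega> in M. continuous_on {0..} (\<lambda>t. W t \<omega>)"
      using brownian by (auto simp: brownian_motion_def)
    then show "AE \<omega> in M. \<forall>\<^sub>F i in sequentially. \<omega> \<notin> S2 i"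
    proof eventually_elim
      case (elim \<omega>)
      obtain d where d: "d > 0" "\<And>t. t \<ge> 0 \<Longrightarrow> t < d \<Longrightarrow> \<bar>W t \<omega>\<bar> < b"
        using elim(2)[unfolded continuous_on_iff, rule_format, of 0 b] elim(1) \<open>b > 0\<close> by (auto simp: dist_real_def)
      have "\<forall>\<^sub>F i in sequentially. Ti i < d" using Ti0 \<open>d > 0\<close> by (rule order_tendstoD)
      then show ?case
      proof eventually_elim
        case (elim i)
        then show ?case using d(2) by (fastforce simp: S2_def)
      qed
    qed
  qed
  then have E2: "\<forall>\<^sub>F i in sequentially. measure M (S2 i) < \<eta>" using \<open>\<eta> > 0\<close> by (rule order_tendstoD)
  obtain i where i: "measure M (S1 i) < \<eta>" "measure M (S2 i) < \<eta>"
    using eventually_conj[OF E1 E2] by (auto simp: eventually_sequentially)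
  define T where "T = Ti i"
  have T: "T > 0" "T \<in> \<rat>" using Ti by (auto simp: T_def)

  \<comment> \<open>Localisation of the martingale part up to \<open>T\<close>\<close>
  define S3 where "S3 m = {\<omega>\<in>space M. \<sigma> m \<omega> \<le> ennreal T}" for m
  have S3m [measurable]: "S3 m \<in> sets M" for m
    unfolding S3_def using T sets_F[OF _ stopping_time_measurable(1)[OF \<sigma>(1)], of T] by simp
  have "(\<lambda>m. measure M (S3 m)) \<longlonglongrightarrow> 0"
  proof (rule measure_tendsto_0_of_AE_eventually_not_in[OF S3m])
    show "AE \<omega> in M. \<forall>\<^sub>F m in sequentially. \<omega> \<notin> S3 m"
      using \<sigma>(2)
    proof eventually_elim
      case (elim \<omega>)
      then have "\<forall>\<^sub>F m in sequentially. ennreal T < \<sigma> m \<omega>" by (rule order_tendstoD) simp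
      then show ?case by eventually_elim (auto simp: S3_def)
    qed
  qed
  then have "\<forall>\<^sub>F m in sequentially. measure M (S3 m) < \<eta>" using \<open>\<eta> > 0\<close> by (rule order_tendstoD)
  then obtain m where m: "measure M (S3 m) < \<eta>" by (auto simp: eventually_sequentially)

  \<comment> \<open>Grids and the variation of \<open>A\<close> along them\<close>
  define t where "t n k = real k * (T / (2 * real n))" for n k
  have t_nonneg: "t n k \<ge> 0" for n k using T by (simp add: t_def)
  have t_mono: "mono (t n)" for n unfolding t_def using T by (intro monoI mult_right_mono) auto
  have t_le: "t n k \<le> T" if "k \<le> 2 * n" for n k
    using that T by (cases "n = 0") (auto simp: t_def field_simps)
  have t_rat: "t n k \<in> \<rat>" for n k using T by (auto simp: t_def)
  define V where "V n k \<omega> = (\<Sum>j<k. \<bar>A (t n (Suc j)) \<omega> - A (t n j) \<omega>\<bar>)" for n k \<omega>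
  have Vm: "V n k \<in> borel_measurable M" for n k
    unfolding V_def using A_m t_nonneg by measurable
  \<comment> \<open>The union over \<open>n\<close> makes the bad set independent of the grid. It
    still becomes small for large \<open>K\<close>, because one pathwise variation bound on the
    interval from 0 to \<open>T\<close> dominates all grid sums.\<close>
  define S4 where "S4 (K::nat) = (\<Union>n. {\<omega>\<in>space M. real K < V n (2 * n) \<omega>})" for K
  have S4m [measurable]: "S4 K \<in> sets M" for K unfolding S4_def using Vm by measurable
  have "(\<lambda>K. measure M (S4 K)) \<longlonglongrightarrow> 0"
  proof (rule measure_tendsto_0_of_AE_eventually_not_in[OF S4m])
    have "AE \<omega> in M. bounded_variation_on (\<lambda>t. A t \<omega>) 0 T"
      using A T by (auto simp: finite_variation_process_def)
    then show "AE \<omega> in M. \<forall>\<^sub>F K in sequentially. \<omega> \<notin> S4 K"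
    proof eventually_elim
      case (elim \<omega>)
      then obtain B where B: "\<And>(n::nat) s. (\<forall>i\<le>n. 0 \<le> s i \<and> s i \<le> T) \<Longrightarrow> (\<forall>i<n. s i \<le> s (Suc i)) \<Longrightarrow>
        (\<Sum>i<n. \<bar>A (s (Suc i)) \<omega> - A (s i) \<omega>\<bar>) \<le> B"
        unfolding bounded_variation_on_def by metis
      have "V n (2 * n) \<omega> \<le> B" for n
        unfolding V_def using t_nonneg t_le t_mono by (intro B) (auto simp: incseq_SucD)
      moreover have "\<forall>\<^sub>F K in sequentially. B \<le> real K"
        using filterlim_real_sequentially by (simp add: filterlim_at_top)
      ultimately show ?case
        by (auto simp: S4_def not_less elim!: eventually_mono intro: order_trans)
    qed
  qed
  then have "\<forall>\<^sub>F K in sequentially. measure M (S4 K) < \<eta>" using \<open>\<eta> > 0\<close> by (rule order_tendstoD)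
  then obtain K where K: "measure M (S4 K) < \<eta>" by (auto simp: eventually_sequentially)

  \<comment> \<open>The total bad set and the constants\<close>
  define S where "S = S1 i \<union> S2 i \<union> S3 m \<union> S4 K"
  have [measurable]: "S \<in> sets M" by (simp add: S_def)
  have "measure M (D \<inter> S) \<le> measure M S" by (intro finite_measure_mono) auto
  also have "\<dots> \<le> measure M (S1 i) + measure M (S2 i) + measure M (S3 m) + measure M (S4 K)"
    unfolding S_def by (intro order_trans[OF measure_Un_le] add_mono order_refl) auto
  also have "\<dots> \<le> 4 * \<eta>" using i m K by simp
  finally have small: "measure M (D \<inter> S) \<le> (exp (-1) / sqrt 2)\<^sup>2 / 16 * measure M D" by (simp add: \<eta>_def ac_simps)

  define X where "X = stopped L (\<sigma> m)"
  have X: "martingale M F X" unfolding X_def by (rule \<sigma>(3))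
  \<comment> \<open>\<open>r \<le> b\<close> keeps \<open>f\<close> and \<open>g\<close> equal on
    the interval, and \<open>r \<le> sqrt T\<close> places it where the Gaussian lower bound
    holds.\<close>
  define r where "r = min b (sqrt T)"
  have r: "r > 0" "r \<le> b" "r \<le> sqrt T" using \<open>b > 0\<close> T by (auto simp: r_def)
  define C1 where "C1 = 4 * C + 2 * real K + (\<integral>\<omega>. \<bar>X T \<omega>\<bar> \<partial>M)"
  define C2 where "C2 = 2 / T * sqrt (pi * T) * (2 / (exp (-1) / sqrt 2) * (C1 / measure M D) + 2 * C / 8)"

  \<comment> \<open>The estimate for one step size\<close>
  have main: "integral {-r..r} (\<lambda>x. \<bar>heat (T / (2 * real n)) g x - g x\<bar>) \<le> C2 * (T / (2 * real n))"
    if n: "n > 0" for n :: nat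
  proof -
    define N where "N = 2 * n"
    define h where "h = T / (2 * real n)"
    have "h > 0" using T n by (simp add: h_def)
    define \<psi> where "\<psi> x = heat h g x - g x" for x
    define \<phi> where "\<phi> x = indicator {-r..r} x * \<bar>\<psi> x\<bar>" for x
    have \<psi>_cont: "continuous_on UNIV \<psi>"
      unfolding \<psi>_def by (intro continuous_intros g(1) continuous_heat[OF \<open>h > 0\<close> g])
    then have [measurable]: "\<psi> \<in> borel_measurable borel" by (rule borel_measurable_continuous_onI)
    have \<psi>_bd: "\<bar>\<psi> x\<bar> \<le> 2 * C" for x
      using abs_heat_le[where g = g and x = x, OF \<open>h > 0\<close> _ g(2)] g(2)[of x] unfolding \<psi>_def by simp
    have [measurable]: "\<phi> \<in> borel_measurable borel" unfolding \<phi>_def by measurable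
    have abs_int: "set_integrable lborel {-r..r} (\<lambda>x. \<bar>\<psi> x\<bar>)"
      by (intro borel_integrable_atLeastAtMost' continuous_intros continuous_on_subset[OF \<psi>_cont]) auto
    then have \<phi>_int: "integrable lborel \<phi>" by (simp add: set_integrable_def \<phi>_def[abs_def])
    have J: "(\<integral>x. \<phi> x \<partial>lborel) = integral {-r..r} (\<lambda>x. \<bar>\<psi> x\<bar>)"
      using set_borel_integral_eq_integral(2)[OF abs_int] by (simp add: set_lebesgue_integral_def \<phi>_def[abs_def])
    have \<phi>_nonneg: "0 \<le> \<phi> x" and \<phi>_le: "\<phi> x \<le> 2 * C" for x
      using \<psi>_bd[of x] \<open>C > 0\<close> by (auto simp: \<phi>_def indicator_def)
    have supp: "\<phi> z = 0" if "z\<^sup>2 > T" for z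
    proof -
      have "\<bar>z\<bar> > sqrt T" using real_sqrt_less_mono[OF that] by simp
      then show ?thesis using r by (auto simp: \<phi>_def indicator_def)
    qed
    \<comment> \<open>Every condition is decided by time \<open>t n k\<close>:
      \<open>ennreal (t n k) < \<tau> \<omega>\<close> is the complement of an event of
      \<open>F (t n k)\<close>, and \<open>V n k\<close> looks at \<open>A\<close> only up to index
      \<open>k\<close>. The sets are empty from \<open>N\<close> on, so testing ends at
      \<open>T\<close>.\<close>
    define G where "G k = (if k < N then {\<omega>\<in>space M. ennreal (t n k) < \<tau> \<omega>} \<inter> {\<omega>\<in>space M. ennreal (t n k) < \<sigma> m \<omega>} \<inter>
       {\<omega>\<in>space M. \<forall>j\<in>{..k}. \<bar>W (t n j) \<omega>\<bar> \<le> b} \<inter> {\<omega>\<in>space M. V n k \<omega> \<le> real K} else {})" for k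
    have t_Suc: "ennreal (t n k) \<le> ennreal (t n (Suc k))" for k
      by (intro ennreal_leI incseq_SucD t_mono)
    have V_Suc: "V n k \<omega> \<le> V n (Suc k) \<omega>" for k \<omega> by (simp add: V_def)
    have G_m: "G k \<in> sets (F (t n k))" for k
    proof -
      have Wj: "W (t n j) \<in> borel_measurable (F (t n k))" if "j \<le> k" for j
        by (rule measurable_F_mono[OF t_nonneg monoD[OF t_mono that] W_adapted[OF t_nonneg]])
      have Aj: "A (t n j) \<in> borel_measurable (F (t n k))" if "j \<le> k" for j
        by (rule measurable_F_mono[OF t_nonneg monoD[OF t_mono that] A_adapted[OF t_nonneg]])
      have "V n k \<in> borel_measurable (F (t n k))"
        unfolding V_def by (intro borel_measurable_sum borel_measurable_abs borel_measurable_diff Aj) auto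
      then have 1: "{\<omega>\<in>space (F (t n k)). V n k \<omega> \<le> real K} \<in> sets (F (t n k))" by measurable
      have 2: "{\<omega>\<in>space (F (t n k)). \<forall>j\<in>{..k}. \<bar>W (t n j) \<omega>\<bar> \<le> b} \<in> sets (F (t n k))"
        using Wj by (intro sets.sets_Collect_finite_All) (auto intro!: borel_measurable_le)
      show ?thesis
        using 1 2 stopping_time_measurable(2)[OF \<tau>(1) t_nonneg] stopping_time_measurable(2)[OF \<sigma>(1) t_nonneg]
        unfolding G_def space_F[OF t_nonneg] by auto
    qed
    have G_dec: "G (Suc k) \<subseteq> G k" for k
      using t_Suc[of k] V_Suc[of k] by (auto simp: G_def dest: le_less_trans intro: order_trans)
    have GN: "G N = {}" by (simp add: G_def)
    \<comment> \<open>The sign turns the expected gain at \<open>W (t n k)\<close> into its absolute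
      value, and the indicator restricts it to the interval from \<open>-r\<close> to
      \<open>r\<close>.\<close>
    define H where "H k \<omega> = indicator (G k) \<omega> * (indicator {-r..r} (W (t n k) \<omega>) * sgn (\<psi> (W (t n k) \<omega>)))" for k \<omega>
    have H_m: "H k \<in> borel_measurable (F (t n k))" for k
    proof -
      have [measurable]: "G k \<in> sets (F (t n k))" "W (t n k) \<in> borel_measurable (F (t n k))"
        using G_m W_adapted[OF t_nonneg] by auto
      show ?thesis unfolding H_def by measurable
    qed
    have H_bd: "\<bar>H k \<omega>\<bar> \<le> indicator (G k) \<omega>" for k \<omega>
      by (auto simp: H_def indicator_def sgn_if)
    have H1: "\<bar>H k \<omega>\<bar> \<le> 1" for k \<omega> by (rule order_trans[OF H_bd]) (simp add: indicator_def)
    define R where "R k \<omega> = g (W (t n k) \<omega>)" for k \<omega>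
    have [measurable]: "W (t n k) \<in> borel_measurable M" "H k \<in> borel_measurable M" "G k \<in> sets M" for k
      using W_m t_nonneg measurable_F[OF t_nonneg H_m] sets_F[OF t_nonneg G_m] by auto
    have R_m: "R k \<in> borel_measurable M" for k unfolding R_def by measurable
    have tN: "t n N = T" using n by (simp add: t_def N_def)
    have "(\<integral>\<omega>. (\<Sum>k<N. H k \<omega> * (R (Suc k) \<omega> - R k \<omega>)) \<partial>M) \<le> 4 * C + 2 * real K + (\<integral>\<omega>. \<bar>X (t n N) \<omega>\<bar> \<partial>M)"
    proof (rule discrete_quasimartingale_bound[where t = "t n" and A = "\<lambda>k. A (t n k)",
          OF t_nonneg t_mono X G_m G_dec GN H_m H_bd R_m])
      show "\<bar>R k \<omega>\<bar> \<le> C" for k \<omega> by (simp add: R_def g(2))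
      show "AE \<omega> in M. \<forall>k. \<omega> \<in> G k \<longrightarrow> R k \<omega> = R 0 \<omega> + X (t n k) \<omega> + A (t n k) \<omega> \<and> A (t n 0) \<omega> = 0 \<and>
                 (\<Sum>i<k. \<bar>A (t n (Suc i)) \<omega> - A (t n i) \<omega>\<bar>) \<le> real K"
        using decomp
      proof eventually_elim
        case (elim \<omega>)
        show ?case
        proof (intro allI impI)
          fix k assume k: "\<omega> \<in> G k"
          then have *: "\<omega> \<in> space M" "ennreal (t n k) < \<tau> \<omega>" "ennreal (t n k) < \<sigma> m \<omega>" "V n k \<omega> \<le> real K"
            "\<And>j. j \<le> k \<Longrightarrow> \<bar>W (t n j) \<omega>\<bar> \<le> b"
            by (auto simp: G_def split: if_splits)
          \<comment> \<open>Before \<open>\<tau>\<close> and \<open>\<sigma> m\<close> nothing has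
            been stopped, so the decomposition holds for \<open>W\<close> and \<open>X\<close>
            themselves; \<open>fg\<close> carries it from \<open>f\<close> to \<open>g\<close> at
            the two times 0 and \<open>t n k\<close>.\<close>
          have "stopped W \<tau> (t n k) \<omega> = W (t n k) \<omega>" "X (t n k) \<omega> = L (t n k) \<omega>"
            using *(2,3) by (auto simp: stopped_def X_def)
          moreover have "stopped W \<tau> 0 \<omega> = W (t n 0) \<omega>" by (simp add: stopped_def t_def)
          ultimately have "R k \<omega> = R 0 \<omega> + X (t n k) \<omega> + A (t n k) \<omega>"
            using elim[rule_format, OF t_nonneg[of n k]] fg[OF *(5)[of k]] fg[OF *(5)[of 0]] by (simp add: R_def)
          then show "R k \<omega> = R 0 \<omega> + X (t n k) \<omega> + A (t n k) \<omega> \<and> A (t n 0) \<omega> = 0 \<and>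
                 (\<Sum>i<k. \<bar>A (t n (Suc i)) \<omega> - A (t n i) \<omega>\<bar>) \<le> real K"
            using *(1,4) LA0 by (simp add: V_def t_def)
        qed
      qed
    qed simp
    then have up: "(\<integral>\<omega>. (\<Sum>k<N. H k \<omega> * (R (Suc k) \<omega> - R k \<omega>)) \<partial>M) \<le> C1" by (simp add: C1_def tN)
    have HR: "integrable M (\<lambda>\<omega>. H k \<omega> * v (W (t n j) \<omega>))" if [measurable]: "v \<in> borel_measurable borel"
      and v: "\<And>x. \<bar>v x\<bar> \<le> 2 * C" for k j and v :: "real \<Rightarrow> real"
    proof (rule integrable_const_bound[of _ "1 * (2 * C)"])
      show "AE \<omega> in M. norm (H k \<omega> * v (W (t n j) \<omega>)) \<le> 1 * (2 * C)"
        using H1 v unfolding real_norm_def abs_mult by (intro AE_I2 mult_mono) auto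
    qed measurable
    have g2: "\<bar>g x\<bar> \<le> 2 * C" "\<bar>heat h g x\<bar> \<le> 2 * C" for x
      using g(2)[of x] abs_heat_le[where g = g and x = x, OF \<open>h > 0\<close> _ g(2)] \<open>C > 0\<close> by auto
    \<comment> \<open>Given the past, the mean increment of \<open>g\<close> along \<open>W\<close>
      over one grid step is \<open>\<psi> (W (t n k) \<omega>)\<close>.\<close>
    have step: "(\<integral>\<omega>. H k \<omega> * (R (Suc k) \<omega> - R k \<omega>) \<partial>M) = (\<integral>\<omega>. indicator (G k) \<omega> * \<phi> (W (t n k) \<omega>) \<partial>M)" for k
    proof -
      have tt: "t n (Suc k) - t n k = h" by (simp add: t_def h_def algebra_simps add_divide_distrib)
      have "(\<integral>\<omega>. H k \<omega> * (R (Suc k) \<omega> - R k \<omega>) \<partial>M) =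
          (\<integral>\<omega>. H k \<omega> * g (W (t n (Suc k)) \<omega>) \<partial>M) - (\<integral>\<omega>. H k \<omega> * g (W (t n k) \<omega>) \<partial>M)"
        unfolding R_def right_diff_distrib using g2 by (intro Bochner_Integration.integral_diff HR) auto
      also have "(\<integral>\<omega>. H k \<omega> * g (W (t n (Suc k)) \<omega>) \<partial>M) = (\<integral>\<omega>. H k \<omega> * heat h g (W (t n k) \<omega>) \<partial>M)"
        unfolding tt[symmetric]
        by (rule markov_property[OF t_nonneg _ H_m H1 _ g(2)]) (use tt \<open>h > 0\<close> in auto)
      also have "\<dots> - (\<integral>\<omega>. H k \<omega> * g (W (t n k) \<omega>) \<partial>M) = (\<integral>\<omega>. H k \<omega> * \<psi> (W (t n k) \<omega>) \<partial>M)"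
        unfolding \<psi>_def right_diff_distrib using g2 by (intro Bochner_Integration.integral_diff[symmetric] HR) auto
      also have "\<dots> = (\<integral>\<omega>. indicator (G k) \<omega> * \<phi> (W (t n k) \<omega>) \<partial>M)"
        by (intro Bochner_Integration.integral_cong refl) (simp add: H_def \<phi>_def abs_sgn mult.commute)
      finally show ?thesis .
    qed
    have intG: "integrable M (\<lambda>\<omega>. indicator Q \<omega> * \<phi> (W (t n k) \<omega>))" if [measurable]: "Q \<in> sets M" for Q k
      using \<phi>_nonneg \<phi>_le \<open>C > 0\<close> by (intro integrable_const_bound[of _ "2 * C"]) (auto simp: indicator_def)
    have sub: "D - S \<subseteq> G k" if "k < N" for k
    proof
      fix \<omega> assume \<omega>: "\<omega> \<in> D - S"
      have kT: "t n j \<le> T" if "j \<le> k" for j using t_le[of j n] that \<open>k < N\<close> by (simp add: N_def)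
      have sp: "\<omega> \<in> space M" using \<omega> by (simp add: D_def)
      have "ennreal T < \<tau> \<omega>" "ennreal T < \<sigma> m \<omega>"
        using \<omega> sp by (auto simp: S_def S1_def S3_def T_def[symmetric])
      then have 1: "ennreal (t n k) < \<tau> \<omega>" "ennreal (t n k) < \<sigma> m \<omega>"
        using ennreal_leI[OF kT[OF order_refl]] by (auto dest: le_less_trans)
      have 2: "\<bar>W (t n j) \<omega>\<bar> \<le> b" if "j \<le> k" for j
      proof (rule ccontr)
        assume "\<not> \<bar>W (t n j) \<omega>\<bar> \<le> b"
        moreover have "t n j \<in> \<rat> \<inter> {0..Ti i}" using t_rat t_nonneg kT[OF that] by (simp add: T_def)
        ultimately have "\<omega> \<in> S2 i" using sp unfolding S2_def by (intro UN_I) auto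
        with \<omega> show False by (simp add: S_def)
      qed
      have "V n k \<omega> \<le> V n (2 * n) \<omega>"
        unfolding V_def using \<open>k < N\<close> by (intro sum_mono2) (auto simp: N_def)
      also have "\<dots> \<le> real K" using \<omega> sp by (auto simp: S_def S4_def not_less)
      finally show "\<omega> \<in> G k" using 1 2 sp \<open>k < N\<close> by (simp add: G_def)
    qed
    \<comment> \<open>Dropping the times before \<open>n\<close> loses only nonnegative terms, and
      off \<open>S\<close> every \<open>G k\<close> with \<open>k < N\<close> is still active on
      \<open>D\<close>.\<close>
    have "(\<integral>\<omega>. indicator (D - S) \<omega> * (\<Sum>k\<in>{n..<2*n}. \<phi> (W (t n k) \<omega>)) \<partial>M) \<le>
        (\<integral>\<omega>. (\<Sum>k<N. indicator (G k) \<omega> * \<phi> (W (t n k) \<omega>)) \<partial>M)"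
    proof (rule integral_mono)
      show "integrable M (\<lambda>\<omega>. indicator (D - S) \<omega> * (\<Sum>k\<in>{n..<2*n}. \<phi> (W (t n k) \<omega>)))"
        unfolding sum_distrib_left by (intro Bochner_Integration.integrable_sum intG) auto
      show "integrable M (\<lambda>\<omega>. \<Sum>k<N. indicator (G k) \<omega> * \<phi> (W (t n k) \<omega>))"
        by (intro Bochner_Integration.integrable_sum intG) auto
      fix \<omega>
      have "indicator (D - S) \<omega> * (\<Sum>k\<in>{n..<2*n}. \<phi> (W (t n k) \<omega>)) \<le>
          (\<Sum>k\<in>{n..<2*n}. indicator (G k) \<omega> * \<phi> (W (t n k) \<omega>))"
        unfolding sum_distrib_left
      proof (rule sum_mono)
        fix k assume "k \<in> {n..<2*n}"
        then have "indicator (D - S) \<omega> \<le> (indicator (G k) \<omega> :: real)"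
          using sub[of k] by (auto simp: indicator_def N_def)
        then show "indicator (D - S) \<omega> * \<phi> (W (t n k) \<omega>) \<le> indicator (G k) \<omega> * \<phi> (W (t n k) \<omega>)"
          using \<phi>_nonneg by (rule mult_right_mono)
      qed
      also have "\<dots> \<le> (\<Sum>k<N. indicator (G k) \<omega> * \<phi> (W (t n k) \<omega>))"
        using \<phi>_nonneg by (intro sum_mono2) (auto simp: N_def)
      finally show "indicator (D - S) \<omega> * (\<Sum>k\<in>{n..<2*n}. \<phi> (W (t n k) \<omega>)) \<le> \<dots>" .
    qed
    also have "\<dots> = (\<Sum>k<N. \<integral>\<omega>. indicator (G k) \<omega> * \<phi> (W (t n k) \<omega>) \<partial>M)"
      by (intro Bochner_Integration.integral_sum intG) auto
    also have "\<dots> = (\<Sum>k<N. \<integral>\<omega>. H k \<omega> * (R (Suc k) \<omega> - R k \<omega>) \<partial>M)"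
      by (simp only: step)
    also have "\<dots> = (\<integral>\<omega>. (\<Sum>k<N. H k \<omega> * (R (Suc k) \<omega> - R k \<omega>)) \<partial>M)"
      unfolding R_def right_diff_distrib using g2
      by (intro Bochner_Integration.integral_sum[symmetric] Bochner_Integration.integrable_diff HR) auto
    finally have "(\<integral>\<omega>. indicator (D - S) \<omega> * (\<Sum>k\<in>{n..<2*n}. \<phi> (W (t n k) \<omega>)) \<partial>M) \<le> C1"
      using up by linarith
    from occupation_bound_off_small_set[OF D0 Dpos T(1) n \<phi>_int \<phi>_nonneg \<phi>_le _ supp \<open>S \<in> sets M\<close> small this[unfolded t_def]]
    show ?thesis using \<open>C > 0\<close> unfolding J C2_def \<psi>_def h_def by simp
  qed
  show ?thesis
  proof (rule exI[of _ r], intro conjI r(1,2), rule exI[of _ C2],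
      rule exI[of _ "\<lambda>i. T / (2 * real (Suc i))"], intro conjI allI)
    show "integral {-r..r} (\<lambda>x. \<bar>heat (T / (2 * real (Suc i))) g x - g x\<bar>) \<le> C2 * (T / (2 * real (Suc i)))" for i
      by (rule main) simp
    show "0 < T / (2 * real (Suc i))" for i using T by simp
    have "(\<lambda>i. T / 2 * inverse (real (Suc i))) \<longlonglongrightarrow> T / 2 * 0"
      by (intro tendsto_mult_left LIMSEQ_inverse_real_of_nat)
    moreover have "T / (2 * real (Suc i)) = T / 2 * inverse (real (Suc i))" for i
      by (simp only: divide_inverse inverse_mult_distrib mult.assoc)
    ultimately show "(\<lambda>i. T / (2 * real (Suc i))) \<longlonglongrightarrow> 0" by (simp only: mult_zero_right)
  qed
qed

end

theorem theoremB28: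
  fixes M :: "'a measure" and F :: "real \<Rightarrow> 'a measure"
    and W :: "real \<Rightarrow> 'a \<Rightarrow> real" and \<tau> :: "'a \<Rightarrow> ennreal" and f :: "real \<Rightarrow> real"
  assumes "prob_space M"
    and "filtration_on M F"
    and "brownian_motion M F W"
    and "stopping_time_on M F \<tau>"
    and "measure M {\<omega>\<in>space M. 0 < \<tau> \<omega>} > 0"
    and "f \<in> borel_measurable borel"
    and "semimartingale M F (\<lambda>t \<omega>. f (stopped W \<tau> t \<omega>))"
  shows "\<exists>\<delta>>0. \<exists>g h :: real \<Rightarrow> real.
           convex_on {-\<delta><..<\<delta>} g \<and> convex_on {-\<delta><..<\<delta>} h \<and>
           (\<forall>x\<in>{-\<delta><..<\<delta>}. f x = g x - h x)"
proof -
  interpret filtered_brownian M F W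
    using assms by (intro filtered_brownian.intro filtered_brownian_axioms.intro)
  have "AE \<omega> in M. cadlag (\<lambda>t. f (stopped W \<tau> t \<omega>))"
    using assms(7) by (simp add: semimartingale_def)
  then obtain d where d: "d > 0" "\<And>x. \<bar>x\<bar> < d \<Longrightarrow> isCont f x"
    using isCont_near_0_of_cadlag_stopped[OF assms(4,5)] by blast
  \<comment> \<open>Halving \<open>d\<close> leaves a compact interval inside the region of
    continuity, on which \<open>f\<close> is bounded.\<close>
  define b where "b = d / 2"
  have "b > 0" using d(1) by (simp add: b_def)
  have cont: "continuous_on {-b..b} f"
    using d by (intro continuous_at_imp_continuous_on) (auto simp: b_def)
  \<comment> \<open>Clamping the argument extends \<open>f\<close> constantly beyond the interval:
    the heat semigroup is nonlocal and acts on a bounded continuous function on the whole line,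
    while regularity of \<open>f\<close> is known only near 0.\<close>
  define g where "g x = f (max (-b) (min b x))" for x
  have g: "continuous_on UNIV g"
    unfolding g_def using \<open>b > 0\<close>
    by (intro continuous_on_compose2[OF cont] continuous_intros) auto
  have "bounded (f ` {-b..b})" by (intro compact_imp_bounded compact_continuous_image cont) simp
  then obtain C where C: "C > 0" "\<And>x. x \<in> {-b..b} \<Longrightarrow> \<bar>f x\<bar> \<le> C"
    unfolding bounded_pos by auto
  have g_bd: "\<bar>g x\<bar> \<le> C" for x unfolding g_def using \<open>b > 0\<close> by (intro C(2)) auto
  have fg: "f x = g x" if "\<bar>x\<bar> \<le> b" for x
  proof -
    have "max (-b) (min b x) = x" using that by (auto simp: min_def max_def abs_le_iff)
    then show ?thesis by (simp add: g_def)
  qed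
  obtain r K h where r: "r > 0" "r \<le> b" and h: "\<And>i. h i > 0" "h \<longlonglongrightarrow> 0"
    and est: "\<And>i::nat. integral {-r..r} (\<lambda>x. \<bar>heat (h i) g x - g x\<bar>) \<le> K * h i"
    using heat_estimate_of_semimartingale[OF assms(4,5,7) g g_bd C(1) \<open>b > 0\<close> fg] by blast
  have "f x = g x" if "x \<in> {-r<..<r}" for x using that r by (intro fg) auto
  then show ?thesis
    using difference_of_convex_from_heat_estimate[OF g g_bd h r(1) est] r(1) by (intro exI[of _ r]) auto
qed

end
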